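(* Let $\Omega\subset\mathbb{R}^d$ be a regular domain with boundary decomposed as $\partial\Omega=\partial\Omega_D\cup\partial\Omega_N$, let $1<p<\infty$, and let $p'=\frac{p}{p-1}$. (1) Let $\mathbf{Q}$ be a real-valued absolutely continuous vector field on $\Omega$, and let $A$ be a real-valued absolutely continuous tensor field of type $\mathcal{T}_1^1$ (that is, a $d\times d$ real matrix-valued function acting on $\mathbf{Q}$). Suppose that $\nu\cdot A^T\mathbf{Q}\le 0$ a.e. on $\partial\Omega_N$. Then for all $\zeta\in\mathcal{D}(\Omega,\partial\Omega_D)$, $$\int_\Omega |A\nabla\zeta|^p\,dx\ \ge\ \int_\Omega\left\{\operatorname{div}(A^T\mathbf{Q})-(p-1)|\mathbf{Q}|^{p'}\right\}|\zeta|^p\,dx .$$ (2) Let $a$ and $q$ be real-valued absolutely continuous functions on $\Omega$ and let $\mathbf{u}$ be a fixed unit vector in $\mathbb{R}^d$ such that $a\,q\,\mathbf{u}\cdot\nu\le 0$ a.e. on $\partial\Omega_N$. Then for all $\zeta\in\mathcal{D}(\Omega,\partial\Omega_D)$, $$\int_\Omega |a\,\mathbf{u}\cdot\nabla\zeta|^p\,dx\ \ge\ \int_\Omega\left\{\mathbf{u}\cdot\nabla(aq)-(p-1)|q|^{p'}\right\}|\zeta|^p\,dx .$$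
   Context: $\Omega$ is a bounded domain in $\mathbb{R}^d$ whose boundary consists of two pieces, $\partial\Omega_D$ and $\partial\Omega_N:=\partial\Omega\setminus\partial\Omega_D$, each of positive $(d-1)$-dimensional surface measure. $\Omega$ is called regular if its boundary is of class $C$ (locally, in suitable Cartesian coordinates, $\partial\Omega$ is the graph of a continuous function with $\Omega$ lying on one side of it) and is $C^1$ a.e. with respect to surface measure. The outward unit normal $\nu$ exists a.e. on $\partial\Omega_N$. Standing assumption: the boundary is sufficiently regular that Green's formula (the Gauss–Green/divergence theorem) is valid on $\Omega$ for the test functions considered. Test functions: $\mathcal{D}(\Omega,\partial\Omega_D)$ is the set of restrictions to $\Omega$ of (real-valued) functions in $C_c^\infty(\mathbb{R}^d\setminus\partial\Omega_D)$. No boundary condition is imposed on $\partial\Omega_N$. "Absolutely continuous" for vector and tensor fields is understood componentwise, and $A^T$ is the transpose of $A$. *)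

theory Defs
  imports "HOL-Analysis.Analysis"
begin

section \<open>Surface measure\<close>

text \<open>
  Hausdorff measure, normalised so that \<open>(d - 1)\<close>-dimensional Hausdorff measure is the usual
  surface measure.  The empty set is treated separately because \<open>0 ^ 0 = 1\<close> (this matters for
  \<open>k = 0\<close>, where the result is counting measure), and covers consist of bounded sets because
  the library's \<^const>\<open>diameter\<close> is meaningless for unbounded ones.
\<close>

definition hausdorff_gauge :: "nat \<Rightarrow> 'a::metric_space set \<Rightarrow> ennreal" where
  "hausdorff_gauge k U =
    (if U = {} then 0 else ennreal (unit_ball_vol (real k) * (diameter U / 2) ^ k))"

definition hausdorff_pre :: "nat \<Rightarrow> real \<Rightarrow> 'a::metric_space set \<Rightarrow> ennreal" where
  "hausdorff_pre k \<delta> A =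
    (INF U \<in> {U :: nat \<Rightarrow> 'a set. A \<subseteq> (\<Union>i. U i) \<and> (\<forall>i. bounded (U i) \<and> diameter (U i) \<le> \<delta>)}.
       \<Sum>i. hausdorff_gauge k (U i))"

definition hausdorff_outer :: "nat \<Rightarrow> 'a::metric_space set \<Rightarrow> ennreal" where
  "hausdorff_outer k A = (SUP \<delta>\<in>{0<..}. hausdorff_pre k \<delta> A)"

definition hausdorff_measure :: "nat \<Rightarrow> 'a::metric_space measure" where
  "hausdorff_measure k = measure_of UNIV (sets borel) (hausdorff_outer k)"

lemma space_hausdorff_measure [simp]: "space (hausdorff_measure k) = UNIV"
  by (simp add: hausdorff_measure_def)

lemma sets_hausdorff_measure [simp, measurable_cong]: "sets (hausdorff_measure k) = sets borel"
  using sets.sigma_sets_eq[of borel] by (simp add: hausdorff_measure_def)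

lemma hausdorff_pre_mono: "A \<subseteq> B \<Longrightarrow> hausdorff_pre k \<delta> A \<le> hausdorff_pre k \<delta> B"
  unfolding hausdorff_pre_def by (rule INF_superset_mono) auto

lemma hausdorff_pre_antimono: "\<delta> \<le> \<epsilon> \<Longrightarrow> hausdorff_pre k \<epsilon> A \<le> hausdorff_pre k \<delta> A"
  unfolding hausdorff_pre_def by (rule INF_superset_mono) (auto intro: order_trans)

lemma hausdorff_outer_mono: "A \<subseteq> B \<Longrightarrow> hausdorff_outer k A \<le> hausdorff_outer k B"
  unfolding hausdorff_outer_def by (rule SUP_mono) (auto intro: hausdorff_pre_mono)

lemma hausdorff_outer_empty: "hausdorff_outer k {} = 0"
proof -
  have "hausdorff_pre k \<delta> {} \<le> 0" if "\<delta> > 0" for \<delta> :: real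
    unfolding hausdorff_pre_def using that
    by (intro INF_lower2[of "\<lambda>_. {}"]) (auto simp: hausdorff_gauge_def)
  then show ?thesis unfolding hausdorff_outer_def
    by (intro antisym SUP_least) auto
qed

lemma hausdorff_pre_subadditive:
  fixes A :: "nat \<Rightarrow> 'a::metric_space set"
  shows "hausdorff_pre k \<delta> (\<Union>n. A n) \<le> (\<Sum>n. hausdorff_pre k \<delta> (A n))"
proof (cases "(\<Sum>n. hausdorff_pre k \<delta> (A n)) = top")
  case False
  let ?P = "\<lambda>n. hausdorff_pre k \<delta> (A n)"
  show ?thesis
  proof (rule ennreal_le_epsilon)
    fix e :: real assume e: "0 < e"
    have fin: "?P n < top" for n
      using False ennreal_suminf_lessD less_top by blast
    have "\<exists>U. A n \<subseteq> (\<Union>i. U i) \<and> (\<forall>i. bounded (U i) \<and> diameter (U i) \<le> \<delta>) \<and>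
            (\<Sum>i. hausdorff_gauge k (U i)) < ?P n + ennreal (e * (1/2) ^ Suc n)" for n
    proof -
      have "?P n < ?P n + ennreal (e * (1/2) ^ Suc n)"
        using fin[of n] e by (simp add: ennreal_add_left_cancel_less)
      then show ?thesis
        unfolding hausdorff_pre_def[of k \<delta> "A n"] INF_less_iff by auto
    qed
    then obtain U where U: "\<And>n. A n \<subseteq> (\<Union>i. U n i)"
        "\<And>n i. bounded (U n i)" "\<And>n i. diameter (U n i) \<le> \<delta>"
        "\<And>n. (\<Sum>i. hausdorff_gauge k (U n i)) < ?P n + ennreal (e * (1/2) ^ Suc n)"
      by metis
    define W where "W j = (case prod_decode j of (n, i) \<Rightarrow> U n i)" for j
    have cov: "(\<Union>n. A n) \<subseteq> (\<Union>j. W j)"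
    proof
      fix x assume "x \<in> (\<Union>n. A n)"
      then obtain n i where "x \<in> U n i" using U(1) by blast
      then have "x \<in> W (prod_encode (n, i))" by (simp add: W_def)
      then show "x \<in> (\<Union>j. W j)" by blast
    qed
    have "bounded (W j)" "diameter (W j) \<le> \<delta>" for j
      using U(2,3) by (simp_all add: W_def split: prod.split)
    then have "hausdorff_pre k \<delta> (\<Union>n. A n) \<le> (\<Sum>j. hausdorff_gauge k (W j))"
      unfolding hausdorff_pre_def[of k \<delta> "\<Union>n. A n"]
      using cov by (intro INF_lower) simp
    also have "\<dots> = (\<Sum>n. \<Sum>i. hausdorff_gauge k (U n i))"
      using suminf_ennreal_2dimen[where f = "\<lambda>(n, i). hausdorff_gauge k (U n i)"
          and g = "\<lambda>n. \<Sum>i. hausdorff_gauge k (U n i)"]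
      by (simp add: W_def case_prod_unfold)
    also have "\<dots> \<le> (\<Sum>n. ?P n + ennreal (e * (1/2) ^ Suc n))"
      using U(4) by (intro suminf_le) (auto intro: less_imp_le)
    also have "\<dots> = (\<Sum>n. ?P n) + (\<Sum>n. ennreal (e * (1/2) ^ Suc n))"
      by (rule suminf_add[symmetric]) auto
    also have "(\<Sum>n. ennreal (e * (1/2) ^ Suc n)) = ennreal e"
    proof (subst suminf_ennreal_eq)
      show "(\<lambda>n. e * (1/2) ^ Suc n) sums e"
        using sums_mult[OF power_half_series, of e] by simp
    qed (use e in auto)
    finally show "hausdorff_pre k \<delta> (\<Union>n. A n) \<le> (\<Sum>n. ?P n) + ennreal e" .
  qed
qed auto

lemma hausdorff_outer_subadditive:
  "hausdorff_outer k (\<Union>n. A n) \<le> (\<Sum>n. hausdorff_outer k (A n))"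
  unfolding hausdorff_outer_def[of k "\<Union>n. A n"]
proof (rule SUP_least)
  fix \<delta> :: real assume "\<delta> \<in> {0<..}"
  then have "hausdorff_pre k \<delta> (A n) \<le> hausdorff_outer k (A n)" for n
    unfolding hausdorff_outer_def by (rule SUP_upper)
  then have "(\<Sum>n. hausdorff_pre k \<delta> (A n)) \<le> (\<Sum>n. hausdorff_outer k (A n))"
    by (intro suminf_le) auto
  then show "hausdorff_pre k \<delta> (\<Union>n. A n) \<le> (\<Sum>n. hausdorff_outer k (A n))"
    using hausdorff_pre_subadditive order_trans by blast
qed

lemma outer_measure_space_hausdorff: "outer_measure_space (Pow UNIV) (hausdorff_outer k)"
  by (auto simp: outer_measure_space_def positive_def increasing_def countably_subadditive_def
      hausdorff_outer_empty hausdorff_outer_subadditive intro: hausdorff_outer_mono)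

lemma hausdorff_outer_subadditive2:
  "hausdorff_outer k (A \<union> B) \<le> hausdorff_outer k A + hausdorff_outer k B"
proof -
  have "subadditive (Pow UNIV) (hausdorff_outer k :: 'a set \<Rightarrow> ennreal)"
    using outer_measure_space_hausdorff[where 'a = 'a]
      ring_of_sets.countably_subadditive_subadditive
        [OF algebra.axioms(1)[OF sigma_algebra.axioms(1)[OF sigma_algebra_Pow]],
          of UNIV "hausdorff_outer k :: 'a set \<Rightarrow> ennreal"]
    by (simp add: outer_measure_space_def)
  then have disj: "hausdorff_outer k (C \<union> D) \<le> hausdorff_outer k C + hausdorff_outer k D"
    if "C \<inter> D = {}" for C D :: "'a set"
    using that by (auto simp: subadditive_def)
  show ?thesis
    using disj[of A "B - A"] hausdorff_outer_mono[of "B - A" B k]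
    by (auto simp: Un_Diff_cancel intro: order_trans add_left_mono)
qed

lemma hausdorff_outer_separated:
  fixes X Y :: "'a::metric_space set"
  assumes r: "r > 0" and sep: "\<And>x y. x \<in> X \<Longrightarrow> y \<in> Y \<Longrightarrow> r \<le> dist x y"
  shows "hausdorff_outer k X + hausdorff_outer k Y \<le> hausdorff_outer k (X \<union> Y)"
proof -
  have pre: "hausdorff_pre k \<delta> X + hausdorff_pre k \<delta> Y \<le> hausdorff_pre k \<delta> (X \<union> Y)"
    if \<delta>: "0 < \<delta>" "\<delta> < r" for \<delta>
    unfolding hausdorff_pre_def[of k \<delta> "X \<union> Y"]
  proof (rule INF_greatest)
    fix U :: "nat \<Rightarrow> 'a set"
    assume "U \<in> {U. X \<union> Y \<subseteq> (\<Union>i. U i) \<and> (\<forall>i. bounded (U i) \<and> diameter (U i) \<le> \<delta>)}"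
    then have U: "X \<union> Y \<subseteq> (\<Union>i. U i)" "\<And>i. bounded (U i)" "\<And>i. diameter (U i) \<le> \<delta>"
      by auto
    let ?V = "\<lambda>Z i. if U i \<inter> Z = {} then {} else U i"
    have le: "hausdorff_pre k \<delta> Z \<le> (\<Sum>i. hausdorff_gauge k (?V Z i))" if Z: "Z \<subseteq> X \<union> Y" for Z
    proof -
      have "Z \<subseteq> (\<Union>i. ?V Z i)"
      proof
        fix x assume "x \<in> Z"
        then obtain i where "x \<in> U i" using Z U(1) by blast
        with \<open>x \<in> Z\<close> have "x \<in> ?V Z i" by auto
        then show "x \<in> (\<Union>i. ?V Z i)" by blast
      qed
      then show ?thesis
        unfolding hausdorff_pre_def using U(2,3) \<delta>
        by (intro INF_lower) auto
    qed
    have "hausdorff_pre k \<delta> X + hausdorff_pre k \<delta> Y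
        \<le> (\<Sum>i. hausdorff_gauge k (?V X i)) + (\<Sum>i. hausdorff_gauge k (?V Y i))"
      by (intro add_mono le) auto
    also have "\<dots> = (\<Sum>i. hausdorff_gauge k (?V X i) + hausdorff_gauge k (?V Y i))"
      by (rule suminf_add) auto
    also have "\<dots> \<le> (\<Sum>i. hausdorff_gauge k (U i))"
    proof (intro suminf_le)
      fix i
      have "U i \<inter> X = {} \<or> U i \<inter> Y = {}"
      proof (rule ccontr)
        assume "\<not> (U i \<inter> X = {} \<or> U i \<inter> Y = {})"
        then obtain x y where "x \<in> U i" "x \<in> X" "y \<in> U i" "y \<in> Y" by blast
        then have "r \<le> \<delta>"
          using sep diameter_bounded_bound[OF U(2), of x i y] U(3)[of i] by force
        with \<delta> show False by simp
      qed
      then show "hausdorff_gauge k (?V X i) + hausdorff_gauge k (?V Y i) \<le> hausdorff_gauge k (U i)"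
        by (auto simp: hausdorff_gauge_def)
    qed auto
    finally show "hausdorff_pre k \<delta> X + hausdorff_pre k \<delta> Y \<le> (\<Sum>i. hausdorff_gauge k (U i))" .
  qed
  have both: "hausdorff_pre k \<delta> X + hausdorff_pre k \<epsilon> Y \<le> hausdorff_outer k (X \<union> Y)"
    if "\<delta> > 0" "\<epsilon> > 0" for \<delta> \<epsilon>
  proof -
    define m where "m = min (r / 2) (min \<delta> \<epsilon>)"
    have m: "0 < m" "m < r" "m \<le> \<delta>" "m \<le> \<epsilon>" using that r by (auto simp: m_def)
    have "hausdorff_pre k \<delta> X + hausdorff_pre k \<epsilon> Y \<le> hausdorff_pre k m X + hausdorff_pre k m Y"
      using m by (intro add_mono hausdorff_pre_antimono)
    also have "\<dots> \<le> hausdorff_pre k m (X \<union> Y)" using m by (intro pre)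
    also have "\<dots> \<le> hausdorff_outer k (X \<union> Y)"
      unfolding hausdorff_outer_def using m by (intro SUP_upper) auto
    finally show ?thesis .
  qed
  have "hausdorff_pre k \<delta> X + hausdorff_outer k Y \<le> hausdorff_outer k (X \<union> Y)" if "\<delta> > 0" for \<delta>
    unfolding hausdorff_outer_def[of k Y]
    by (subst ennreal_SUP_add_right) (use both that in \<open>auto intro!: SUP_least\<close>)
  then show ?thesis
    unfolding hausdorff_outer_def[of k X]
    by (subst ennreal_SUP_add_left[symmetric]) (auto intro!: SUP_least)
qed

lemma hausdorff_outer_separated_sum:
  fixes R :: "nat \<Rightarrow> 'a::metric_space set"
  assumes r: "\<And>n. r n > 0"
    and sep: "\<And>m n x y. m < n \<Longrightarrow> x \<in> R m \<Longrightarrow> y \<in> R n \<Longrightarrow> r n \<le> dist x y"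
  shows "(\<Sum>m<n. hausdorff_outer k (R m)) \<le> hausdorff_outer k (\<Union>m<n. R m)"
proof (induction n)
  case (Suc n)
  have "(\<Sum>m<Suc n. hausdorff_outer k (R m))
      \<le> hausdorff_outer k (\<Union>m<n. R m) + hausdorff_outer k (R n)"
    using Suc by (simp add: add_right_mono)
  also have "\<dots> \<le> hausdorff_outer k ((\<Union>m<n. R m) \<union> R n)"
    by (rule hausdorff_outer_separated[OF r[of n]]) (use sep in auto)
  also have "(\<Union>m<n. R m) \<union> R n = (\<Union>m<Suc n. R m)"
    by (auto simp: lessThan_Suc)
  finally show ?case .
qed auto

lemma infdist_diff_le_dist: "infdist x C - infdist y C \<le> dist x y"
  using infdist_triangle[of x C y] by simp

lemma hausdorff_outer_closed_split:
  fixes C :: "'a::metric_space set"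
  assumes C: "closed C" "C \<noteq> {}"
  shows "hausdorff_outer k (A \<inter> C) + hausdorff_outer k (A - C) \<le> hausdorff_outer k A"
proof (cases "hausdorff_outer k A = top")
  case False
  let ?H = "hausdorff_outer k :: 'a set \<Rightarrow> ennreal"
  define B where "B n = {x \<in> A. infdist x C \<ge> 1 / (real n + 1)}" for n :: nat
  define R where "R n = B (Suc n) - B n" for n
  have Rlow: "infdist x C \<ge> 1 / (real n + 2)" and Rup: "infdist x C < 1 / (real n + 1)"
    if "x \<in> R n" for x n
    using that by (auto simp: R_def B_def not_le add.commute)
  have RA: "R n \<subseteq> A" for n by (auto simp: R_def B_def)
  have par: "(\<Sum>m<n. ?H (R (2 * m + j))) \<le> ?H A" for n j
  proof -
    define \<rho> where "\<rho> m = 1 / (real (2 * m + j)) - 1 / (real (2 * m + j) + 1)" for m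
    let ?r = "\<lambda>m. if m = 0 then 1 else \<rho> m"
    have "(\<Sum>m<n. ?H (R (2 * m + j))) \<le> ?H (\<Union>m<n. R (2 * m + j))"
    proof (rule hausdorff_outer_separated_sum[where r = ?r])
      show "?r m > 0" for m by (auto simp: \<rho>_def intro!: divide_strict_left_mono mult_pos_pos)
    next
      fix m l x y assume ml: "m < l" and xy: "x \<in> R (2 * m + j)" "y \<in> R (2 * l + j)"
      have "1 / real (2 * l + j) \<le> 1 / (real (2 * m + j) + 2)"
        using ml by (intro divide_left_mono) auto
      then have "?r l \<le> infdist x C - infdist y C"
        using ml Rlow[OF xy(1)] Rup[OF xy(2)] by (auto simp: \<rho>_def)
      then show "?r l \<le> dist x y" using infdist_diff_le_dist order_trans by blast
    qed
    also have "\<dots> \<le> ?H A" using RA by (intro hausdorff_outer_mono) auto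
    finally show ?thesis .
  qed
  have half: "(\<Sum>m<2*n. ?H (R m)) = (\<Sum>m<n. ?H (R (2*m))) + (\<Sum>m<n. ?H (R (2*m+1)))" for n
    by (induction n) (auto simp: algebra_simps)
  have "(\<Sum>m<n. ?H (R m)) \<le> ?H A + ?H A" for n
  proof -
    have "(\<Sum>m<n. ?H (R m)) \<le> (\<Sum>m<2*n. ?H (R m))" by (intro sum_mono2) auto
    also have "\<dots> \<le> ?H A + ?H A"
      unfolding half using par[where j = 0] par[where j = 1] by (intro add_mono) auto
    finally show ?thesis .
  qed
  then have "(\<Sum>m. ?H (R m)) \<le> ?H A + ?H A"
    by (intro suminf_le_const) auto
  with False have fin: "(\<Sum>m. ?H (R m)) \<noteq> top"
    by (auto simp: top_unique)
  have tail: "(\<lambda>n. \<Sum>m. ?H (R (m + n))) \<longlonglongrightarrow> 0"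
  proof -
    define h where "h m = enn2real (?H (R m))" for m
    have ne: "?H (R m) \<noteq> top" for m
      using fin ennreal_suminf_lessD[of "\<lambda>m. ?H (R m)" top m] by (auto simp: less_top)
    then have h: "?H (R m) = ennreal (h m)" "h m \<ge> 0" for m
      by (auto simp: h_def less_top)
    have sm: "summable h"
      using fin h by (intro summable_suminf_not_top) auto
    then have "(\<lambda>n. \<Sum>m. h (m + n)) \<longlonglongrightarrow> 0" by (rule suminf_exist_split2)
    then have "(\<lambda>n. ennreal (\<Sum>m. h (m + n))) \<longlonglongrightarrow> ennreal 0" by (rule tendsto_ennrealI)
    moreover have "(\<Sum>m. ?H (R (m + n))) = ennreal (\<Sum>m. h (m + n))" for n
      unfolding h(1) using sm h(2) by (intro suminf_ennreal2) (auto simp: summable_iff_shift)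
    ultimately show ?thesis by simp
  qed
  have cover: "A - C \<subseteq> B n \<union> (\<Union>m. R (m + n))" for n
  proof
    fix x assume x: "x \<in> A - C"
    then have pos: "infdist x C > 0"
      using C infdist_pos_not_in_closed by blast
    obtain N where N: "x \<in> B N"
    proof -
      obtain N where "inverse (real (Suc N)) < infdist x C"
        using reals_Archimedean[OF pos] by blast
      then have "x \<in> B N" using x by (auto simp: B_def inverse_eq_divide add.commute)
      then show ?thesis using that by blast
    qed
    define L where "L = (LEAST l. x \<in> B l)"
    have L: "x \<in> B L" "\<And>l. l < L \<Longrightarrow> x \<notin> B l"
      using LeastI[of "\<lambda>l. x \<in> B l", OF N] not_less_Least unfolding L_def by auto
    show "x \<in> B n \<union> (\<Union>m. R (m + n))"
    proof (cases "L \<le> n")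
      case True
      then have "1 / (real n + 1) \<le> 1 / (real L + 1)" by (intro divide_left_mono) auto
      with L(1) have "x \<in> B n" by (auto simp: B_def)
      then show ?thesis by simp
    next
      case False
      then obtain l where l: "L = Suc l" "n \<le> l" by (cases L) auto
      then have "x \<in> R ((l - n) + n)" using L(1) L(2)[of l] by (auto simp: R_def)
      then show ?thesis by blast
    qed
  qed
  have step: "?H (A \<inter> C) + ?H (A - C) \<le> ?H A + (\<Sum>m. ?H (R (m + n)))" for n
  proof -
    have "?H (A - C) \<le> ?H (B n \<union> (\<Union>m. R (m + n)))" by (rule hausdorff_outer_mono[OF cover])
    also have "\<dots> \<le> ?H (B n) + (\<Sum>m. ?H (R (m + n)))"
      using hausdorff_outer_subadditive2 hausdorff_outer_subadditive[of k "\<lambda>m. R (m + n)"]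
      by (meson add_left_mono order_trans)
    finally have 1: "?H (A \<inter> C) + ?H (A - C) \<le> (?H (A \<inter> C) + ?H (B n)) + (\<Sum>m. ?H (R (m + n)))"
      by (simp add: add.assoc add_left_mono)
    have "?H (A \<inter> C) + ?H (B n) \<le> ?H (A \<inter> C \<union> B n)"
    proof (rule hausdorff_outer_separated[where r = "1 / (real n + 1)"])
      fix x y assume "x \<in> A \<inter> C" "y \<in> B n"
      then show "1 / (real n + 1) \<le> dist x y"
        using infdist_le[of x C y] by (auto simp: B_def dist_commute)
    qed auto
    also have "\<dots> \<le> ?H A" by (intro hausdorff_outer_mono) (auto simp: B_def)
    finally show ?thesis using 1 by (meson add_right_mono order_trans)
  qed
  have "(\<lambda>n. ?H A + (\<Sum>m. ?H (R (m + n)))) \<longlonglongrightarrow> ?H A + 0"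
    by (intro tendsto_add tendsto_const tail)
  then show ?thesis
    by (intro LIMSEQ_le_const[where X = "\<lambda>n. ?H A + (\<Sum>m. ?H (R (m + n)))"]) (use step in auto)
qed auto

theorem emeasure_hausdorff_measure:
  fixes A :: "'a::metric_space set"
  assumes "A \<in> sets borel"
  shows "emeasure (hausdorff_measure k) A = hausdorff_outer k A"
proof -
  let ?L = "lambda_system UNIV (Pow UNIV) (hausdorff_outer k :: 'a set \<Rightarrow> ennreal)"
  have ms: "measure_space UNIV ?L (hausdorff_outer k)"
    using sigma_algebra.caratheodory_lemma[OF sigma_algebra_Pow outer_measure_space_hausdorff] .
  have closed: "C \<in> ?L" if "closed C" for C :: "'a set"
  proof (cases "C = {}")
    case False
    have "hausdorff_outer k (C \<inter> X) + hausdorff_outer k ((UNIV - C) \<inter> X) = hausdorff_outer k X" for X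
    proof (rule antisym)
      show "hausdorff_outer k (C \<inter> X) + hausdorff_outer k ((UNIV - C) \<inter> X) \<le> hausdorff_outer k X"
        using hausdorff_outer_closed_split[OF that False, of k X]
        by (simp add: Int_commute Diff_eq)
      have "hausdorff_outer k X = hausdorff_outer k (C \<inter> X \<union> (UNIV - C) \<inter> X)"
        by (rule arg_cong[where f = "hausdorff_outer k"]) auto
      then show "hausdorff_outer k X \<le> hausdorff_outer k (C \<inter> X) + hausdorff_outer k ((UNIV - C) \<inter> X)"
        using hausdorff_outer_subadditive2 by metis
    qed
    then show ?thesis by (auto simp: lambda_system_def)
  qed (auto simp: lambda_system_def hausdorff_outer_empty)
  have sub: "sets borel \<subseteq> ?L"
  proof -
    have "sigma_sets UNIV (Collect closed) \<subseteq> ?L"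
      using closed ms by (intro sigma_algebra.sigma_sets_subset) (auto simp: measure_space_def)
    then show ?thesis by (simp add: borel_eq_closed)
  qed
  have "countably_additive (sets borel) (hausdorff_outer k :: 'a set \<Rightarrow> ennreal)"
    using ms sub unfolding measure_space_def countably_additive_def by (meson order_trans subsetD)
  moreover have "positive (sets borel) (hausdorff_outer k :: 'a set \<Rightarrow> ennreal)"
    by (simp add: positive_def hausdorff_outer_empty)
  ultimately show ?thesis
    unfolding hausdorff_measure_def using assms
    by (intro emeasure_measure_of_sigma) (auto simp: sets.sigma_algebra_axioms[of borel, simplified])
qed

abbreviation surface_measure :: "(real^'n::finite) measure" where
  "surface_measure \<equiv> hausdorff_measure (CARD('n) - 1)"


section \<open>Partial derivatives and smooth functions\<close>

definition partial :: "'n::finite \<Rightarrow> (real^'n \<Rightarrow> real) \<Rightarrow> real^'n \<Rightarrow> real" where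
  "partial i f x = deriv (\<lambda>t. f (x + t *\<^sub>R axis i 1)) 0"

definition grad :: "(real^'n::finite \<Rightarrow> real) \<Rightarrow> real^'n \<Rightarrow> real^'n" where
  "grad f x = (\<chi> i. partial i f x)"

definition divergence :: "(real^'n::finite \<Rightarrow> real^'n) \<Rightarrow> real^'n \<Rightarrow> real" where
  "divergence V x = (\<Sum>i\<in>UNIV. partial i (\<lambda>y. V y $ i) x)"

primrec C_k :: "nat \<Rightarrow> (real^'n::finite \<Rightarrow> real) \<Rightarrow> bool" where
  "C_k 0 f \<longleftrightarrow> continuous_on UNIV f"
| "C_k (Suc k) f \<longleftrightarrow> (\<forall>x. f differentiable (at x)) \<and> (\<forall>i. C_k k (partial i f))"

definition Cc_infinity :: "(real^'n::finite) set \<Rightarrow> (real^'n \<Rightarrow> real) set" where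
  "Cc_infinity U = {\<phi>. (\<forall>k. C_k k \<phi>) \<and>
     compact (closure {x. \<phi> x \<noteq> 0}) \<and> closure {x. \<phi> x \<noteq> 0} \<subseteq> U}"

text \<open>
  A restriction to \<open>\<Omega>\<close> is represented by any total function with the prescribed values on \<open>\<Omega>\<close>;
  its values outside \<open>\<Omega>\<close> are irrelevant.
\<close>

definition test_functions :: "(real^'n::finite) set \<Rightarrow> (real^'n) set \<Rightarrow> (real^'n \<Rightarrow> real) set" where
  "test_functions \<Omega> \<Gamma>\<^sub>D = {\<zeta>. \<exists>\<phi>\<in>Cc_infinity (- \<Gamma>\<^sub>D). \<forall>x\<in>\<Omega>. \<zeta> x = \<phi> x}"


section \<open>Regular domains and their boundary\<close>

text \<open>
  Cartesian coordinates are described by the direction \<open>e\<close> of the vertical axis; the function \<open>g\<close>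
  of the remaining \<open>d - 1\<close> coordinates is a function on the whole space that is only evaluated at
  orthogonal projections to the hyperplane \<open>e\<^sup>\<bottom>\<close>.
\<close>

definition local_graph ::
    "(real^'n::finite) set \<Rightarrow> real^'n \<Rightarrow> real^'n \<Rightarrow> (real^'n \<Rightarrow> real) \<Rightarrow> bool" where
  "local_graph \<Omega> x e g \<longleftrightarrow> norm e = 1 \<and>
     (\<exists>U. open U \<and> x \<in> U \<and>
       \<Omega> \<inter> U = {y\<in>U. y \<bullet> e < g (y - (y \<bullet> e) *\<^sub>R e)} \<and>
       frontier \<Omega> \<inter> U = {y\<in>U. y \<bullet> e = g (y - (y \<bullet> e) *\<^sub>R e)})"

definition boundary_C_k_at :: "nat \<Rightarrow> (real^'n::finite) set \<Rightarrow> real^'n \<Rightarrow> bool" where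
  "boundary_C_k_at k \<Omega> x \<longleftrightarrow> (\<exists>e g. C_k k g \<and> local_graph \<Omega> x e g)"

definition regular_domain :: "(real^'n::finite) set \<Rightarrow> bool" where
  "regular_domain \<Omega> \<longleftrightarrow> open \<Omega> \<and> connected \<Omega> \<and> \<Omega> \<noteq> {} \<and> bounded \<Omega> \<and>
     (\<forall>x\<in>frontier \<Omega>. boundary_C_k_at 0 \<Omega> x) \<and>
     (AE x in surface_measure. x \<in> frontier \<Omega> \<longrightarrow> boundary_C_k_at 1 \<Omega> x)"

definition boundary_decomposition :: "(real^'n::finite) set \<Rightarrow> (real^'n) set \<Rightarrow> (real^'n) set \<Rightarrow> bool" where
  "boundary_decomposition \<Omega> \<Gamma>\<^sub>D \<Gamma>\<^sub>N \<longleftrightarrow>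
     \<Gamma>\<^sub>D \<subseteq> frontier \<Omega> \<and> \<Gamma>\<^sub>N = frontier \<Omega> - \<Gamma>\<^sub>D \<and> \<Gamma>\<^sub>D \<in> sets borel \<and>
     emeasure surface_measure \<Gamma>\<^sub>D > 0 \<and> emeasure surface_measure \<Gamma>\<^sub>N > 0"

text \<open>
  \<open>n\<close> is the outward normal at \<open>x\<close> if every open cone around \<open>- n\<close> narrower than a half-space is,
  near \<open>x\<close>, inside \<open>\<Omega>\<close>, and every such cone around \<open>n\<close> is outside.  Where the boundary is \<open>C\<^sup>1\<close>
  this is the usual normal, independently of the chart.  There is at most one such \<open>n\<close>; the value
  \<open>0\<close> marks the points without a normal.
\<close>

definition is_outward_normal :: "(real^'n::finite) set \<Rightarrow> real^'n \<Rightarrow> real^'n \<Rightarrow> bool" where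
  "is_outward_normal \<Omega> x n \<longleftrightarrow> x \<in> frontier \<Omega> \<and> norm n = 1 \<and>
     (\<forall>\<epsilon>>0. \<exists>r>0. \<forall>y\<in>ball x r.
        ((y - x) \<bullet> n < - \<epsilon> * norm (y - x) \<longrightarrow> y \<in> \<Omega>) \<and>
        ((y - x) \<bullet> n > \<epsilon> * norm (y - x) \<longrightarrow> y \<notin> \<Omega>))"

definition outward_normal :: "(real^'n::finite) set \<Rightarrow> real^'n \<Rightarrow> real^'n" where
  "outward_normal \<Omega> x =
     (if \<exists>n. is_outward_normal \<Omega> x n then THE n. is_outward_normal \<Omega> x n else 0)"

lemma is_outward_normal_unique:
  assumes m: "is_outward_normal \<Omega> x m" and n: "is_outward_normal \<Omega> x n"
  shows "m = n"
proof (rule ccontr)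
  assume "m \<noteq> n"
  have unit: "m \<bullet> m = 1" "n \<bullet> n = 1"
    using m n by (auto simp: is_outward_normal_def norm_eq_1)
  define w where "w = n - m"
  define c where "c = 1 - m \<bullet> n"
  have "w \<bullet> w > 0" using \<open>m \<noteq> n\<close> by (simp add: w_def)
  moreover have "w \<bullet> w = 2 * c"
    using unit by (simp add: w_def c_def inner_diff inner_commute)
  ultimately have c: "c > 0" by simp
  have w: "w \<bullet> n = c" "w \<bullet> m = - c" "norm w > 0"
    using unit \<open>m \<noteq> n\<close> by (auto simp: w_def c_def inner_diff inner_commute)
  define \<epsilon> where "\<epsilon> = c / (2 * norm w)"
  have \<epsilon>: "\<epsilon> > 0" "\<epsilon> * norm w < c" using c w(3) by (auto simp: \<epsilon>_def)
  obtain r s where rs: "r > 0" "s > 0"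
      "\<And>y. y \<in> ball x r \<Longrightarrow> (y - x) \<bullet> m < - \<epsilon> * norm (y - x) \<Longrightarrow> y \<in> \<Omega>"
      "\<And>y. y \<in> ball x s \<Longrightarrow> (y - x) \<bullet> n > \<epsilon> * norm (y - x) \<Longrightarrow> y \<notin> \<Omega>"
    using m n \<epsilon>(1) unfolding is_outward_normal_def by metis
  define t where "t = min r s / (2 * norm w)"
  have t: "t > 0" using rs w(3) by (simp add: t_def)
  have "t * norm w = min r s / 2" using w(3) by (simp add: t_def)
  then have near: "t * norm w < r" "t * norm w < s" using rs(1,2) by auto
  have "t * (\<epsilon> * norm w) < t * c" using t \<epsilon>(2) by simp
  then have "x + t *\<^sub>R w \<in> \<Omega>" "x + t *\<^sub>R w \<notin> \<Omega>"
    using rs(3,4)[of "x + t *\<^sub>R w"] near t w(1,2) by (auto simp: dist_norm algebra_simps)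
  then show False by simp
qed


section \<open>Absolute continuity\<close>

definition abs_cont_on_interval :: "real \<Rightarrow> real \<Rightarrow> (real \<Rightarrow> real) \<Rightarrow> bool" where
  "abs_cont_on_interval a b f \<longleftrightarrow>
     (\<forall>\<epsilon>>0. \<exists>\<delta>>0. \<forall>(n::nat) s t.
        (\<forall>j<n. a \<le> s j \<and> s j \<le> t j \<and> t j \<le> b) \<and> (\<forall>j. Suc j < n \<longrightarrow> t j \<le> s (Suc j)) \<and>
        (\<Sum>j<n. t j - s j) < \<delta> \<longrightarrow>
        (\<Sum>j<n. \<bar>f (t j) - f (s j)\<bar>) < \<epsilon>)"

text \<open>
  Absolute continuity in several variables in the sense of Tonelli: \<open>f\<close> is continuous, absolutely
  continuous on the segments in \<open>\<Omega>\<close> of almost every line parallel to a coordinate axis, and its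
  partial derivatives are integrable.  That they exist a.e. follows from the previous clause, by
  Lebesgue's theorem.  (A set of points that is a union of parallel lines is null iff almost no
  line belongs to it, so that quantifying over almost every point \<open>x\<close> amounts to quantifying over
  almost every line.)

  Boundary values are those of the continuous extension, which \<open>f\<close> itself is assumed to provide.
  A part \<open>\<Gamma>\<close> of the boundary is exempted: \<open>f\<close> may be singular there, and continuity and
  integrability are only required away from \<open>\<Gamma>\<close>.  For \<open>\<Gamma> = {}\<close> this is (global) absolute
  continuity; for \<open>d = 1\<close> and an interval \<open>\<Omega>\<close> it is then the usual notion.
\<close>

definition abs_cont :: "(real^'n::finite) set \<Rightarrow> (real^'n) set \<Rightarrow> (real^'n \<Rightarrow> real) \<Rightarrow> bool" where
  "abs_cont \<Omega> \<Gamma> f \<longleftrightarrow>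
     continuous_on (closure \<Omega> - \<Gamma>) f \<and>
     (\<forall>i. (AE x in lebesgue. \<forall>a b. a \<le> b \<and> (\<forall>t\<in>{a..b}. x + t *\<^sub>R axis i 1 \<in> \<Omega>) \<longrightarrow>
             abs_cont_on_interval a b (\<lambda>t. f (x + t *\<^sub>R axis i 1))) \<and>
          (AE x in lebesgue. x \<in> \<Omega> \<longrightarrow> (\<lambda>t. f (x + t *\<^sub>R axis i 1)) differentiable (at 0)) \<and>
          (\<forall>K. compact K \<and> K \<inter> \<Gamma> = {} \<longrightarrow> set_integrable lebesgue (\<Omega> \<inter> K) (partial i f)))"

lemma abs_cont_mono: "abs_cont \<Omega> \<Gamma> f \<Longrightarrow> \<Gamma> \<subseteq> \<Gamma>' \<Longrightarrow> abs_cont \<Omega> \<Gamma>' f"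
  unfolding abs_cont_def by (auto elim!: continuous_on_subset) blast

definition abs_cont_vec ::
    "(real^'n::finite) set \<Rightarrow> (real^'n) set \<Rightarrow> (real^'n \<Rightarrow> real^'n) \<Rightarrow> bool" where
  "abs_cont_vec \<Omega> \<Gamma> V \<longleftrightarrow> (\<forall>i. abs_cont \<Omega> \<Gamma> (\<lambda>x. V x $ i))"

definition abs_cont_mat ::
    "(real^'n::finite) set \<Rightarrow> (real^'n) set \<Rightarrow> (real^'n \<Rightarrow> real^'n^'n) \<Rightarrow> bool" where
  "abs_cont_mat \<Omega> \<Gamma> A \<longleftrightarrow> (\<forall>i j. abs_cont \<Omega> \<Gamma> (\<lambda>x. A x $ i $ j))"


section \<open>Green's formula\<close>

text \<open>
  Validity of Green's formula is a condition on the domain and the boundary piece only.  The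
  boundary integral is over \<open>\<Gamma>\<^sub>N\<close> because \<open>\<phi>\<close> vanishes near \<open>\<Gamma>\<^sub>D\<close>; the integrands over \<open>\<Omega>\<close> are
  always integrable, whereas integrability over \<open>\<Gamma>\<^sub>N\<close> is part of the condition.
\<close>

definition greens_formula_valid :: "(real^'n::finite) set \<Rightarrow> (real^'n) set \<Rightarrow> (real^'n) set \<Rightarrow> bool" where
  "greens_formula_valid \<Omega> \<Gamma>\<^sub>D \<Gamma>\<^sub>N \<longleftrightarrow>
     (\<forall>V. \<forall>\<phi>\<in>Cc_infinity (- \<Gamma>\<^sub>D). abs_cont_vec \<Omega> {} V \<longrightarrow>
        set_integrable surface_measure \<Gamma>\<^sub>N (\<lambda>x. \<phi> x * (V x \<bullet> outward_normal \<Omega> x)) \<and>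
        (LINT x:\<Omega>|lebesgue. \<phi> x * divergence V x) =
          (LINT x:\<Gamma>\<^sub>N|surface_measure. \<phi> x * (V x \<bullet> outward_normal \<Omega> x)) -
          (LINT x:\<Omega>|lebesgue. V x \<bullet> grad \<phi> x))"

end

(*
  With W = A^T Q, Green's formula for the weight |zeta|^p bounds the integral of |zeta|^p div W by
  that of -p |zeta|^(p-2) zeta Q . (A grad zeta), and Young's inequality concludes.  As |zeta|^p is
  not smooth, Green's formula is applied to the test function zeta and the field h(zeta) W, where
  h(t) = t (t^2 + e)^(p/2 - 1); then e tends to 0.  This field is absolutely continuous up to
  the Dirichlet part because zeta is supported away from it.  The scalar statement is the case
  A = a u u^T, Q = q u.
*)
theory Submission
  imports Defs
begin

section \<open>Set integrals\<close>

text \<open>The data may be singular at \<open>\<Gamma>\<^sub>D\<close>, whereas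
  \<open>greens_formula_valid\<close> accepts only fields that are absolutely continuous up to the
  whole boundary, and only smooth test functions. Splitting t h(t) answers both demands: the factor
  t is the given test function, and the factor h(t), which vanishes at t = 0, confines W to the
  support of that function. The unregularised choice |t|^(p-2) t fails for p < 2, since its
  derivative blows up at 0; adding e restores class C^1, which is enough for a factor of the field.
  As t h(t) \<ge> 0, the boundary integral is discarded by its sign for every e, so only two
  integrals over \<Omega> pass to the limit. They have majorants independent of e because t h(t) and
  its derivative stay bounded for bounded t, although for p < 2 the derivative of h alone does
  not.\<close>

lemma compact_continuous_abs_bound:
  fixes f :: "'a::topological_space \<Rightarrow> real"
  assumes "compact S" "continuous_on S f"
  obtains B where "\<And>x. x \<in> S \<Longrightarrow> \<bar>f x\<bar> \<le> B"
  using compact_imp_bounded[OF compact_continuous_image[OF assms(2,1)]]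
  unfolding bounded_iff by auto

text \<open>Lebesgue measure is complete, so measurability passes from \<open>f\<close> to
  \<open>g\<close>. This matters because product rules for \<open>partial\<close> hold only almost
  everywhere, and integrability of a differentiated product has to be read off from its
  expansion.\<close>

lemma set_integrable_lebesgue_cong_AE:
  fixes f g :: "'a::euclidean_space \<Rightarrow> real"
  assumes f: "set_integrable lebesgue A f" and eq: "AE x in lebesgue. x \<in> A \<longrightarrow> f x = g x"
  shows "set_integrable lebesgue A g" and "(LINT x:A|lebesgue. g x) = (LINT x:A|lebesgue. f x)"
proof -
  have f': "(\<lambda>x. indicator A x *\<^sub>R f x) \<in> borel_measurable lebesgue"
    using f by (auto simp: set_integrable_def)
  have eq': "AE x in lebesgue. indicator A x *\<^sub>R f x = indicator A x *\<^sub>R g x"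
    using eq by eventually_elim (auto simp: indicator_def)
  have g': "(\<lambda>x. indicator A x *\<^sub>R g x) \<in> borel_measurable lebesgue"
    by (rule borel_measurable_AE[OF f' eq'])
  show "set_integrable lebesgue A g"
    using f integrable_cong_AE[OF f' g' eq'] by (simp add: set_integrable_def)
  show "(LINT x:A|lebesgue. g x) = (LINT x:A|lebesgue. f x)"
    using integral_cong_AE[OF f' g' eq'] by (simp add: set_lebesgue_integral_def)
qed

text \<open>Lets integrals over \<Omega> be treated on the part of \<Omega> inside the support of
  the test function, where the data are under control.\<close>

lemma set_integrable_IntD:
  fixes f :: "'a \<Rightarrow> real"
  assumes "set_integrable M (A \<inter> K) f" "\<And>x. x \<in> A - K \<Longrightarrow> f x = 0"
  shows "set_integrable M A f"
proof -
  have "(\<lambda>x. indicator (A \<inter> K) x *\<^sub>R f x) = (\<lambda>x. indicator A x *\<^sub>R f x)"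
    using assms(2) by (auto simp: indicator_def fun_eq_iff)
  then show ?thesis using assms(1) by (simp add: set_integrable_def)
qed

text \<open>Meant for a bounded continuous weight times a partial derivative or a divergence, of
  which only integrability is known.\<close>

lemma set_integrable_continuous_mult:
  fixes f g :: "'a::euclidean_space \<Rightarrow> real"
  assumes S: "S \<in> sets borel" and f: "continuous_on S f" "\<And>x. x \<in> S \<Longrightarrow> \<bar>f x\<bar> \<le> B"
    and g: "set_integrable lebesgue S g"
  shows "set_integrable lebesgue S (\<lambda>x. f x * g x)"
proof -
  have mf: "(\<lambda>x. indicator S x *\<^sub>R f x) \<in> borel_measurable lebesgue"
    by (intro measurable_completion) (use borel_measurable_continuous_on_indicator[OF S f(1)] in simp)
  have g': "integrable lebesgue (\<lambda>x. B * (indicator S x *\<^sub>R g x))"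
    using g by (simp add: set_integrable_def)
  have "integrable lebesgue (\<lambda>x. (indicator S x *\<^sub>R f x) * (indicator S x *\<^sub>R g x))"
  proof (rule Bochner_Integration.integrable_bound[OF g'])
    show "(\<lambda>x. (indicator S x *\<^sub>R f x) * (indicator S x *\<^sub>R g x)) \<in> borel_measurable lebesgue"
      using mf g by (intro borel_measurable_times) (auto simp: set_integrable_def)
    have "\<bar>f x\<bar> * \<bar>g x\<bar> \<le> \<bar>B\<bar> * \<bar>g x\<bar>" if "x \<in> S" for x
      using f(2)[OF that] by (intro mult_right_mono) auto
    then show "AE x in lebesgue. norm ((indicator S x *\<^sub>R f x) * (indicator S x *\<^sub>R g x))
        \<le> norm (B * (indicator S x *\<^sub>R g x))"
      by (intro AE_I2) (auto simp: indicator_def abs_mult)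
  qed
  also have "(\<lambda>x. (indicator S x *\<^sub>R f x) * (indicator S x *\<^sub>R g x)) =
      (\<lambda>x. indicator S x *\<^sub>R (f x * g x))"
    by (auto simp: indicator_def)
  finally show ?thesis by (simp add: set_integrable_def)
qed

text \<open>Continuity is asked for on \<open>closure \<Omega> \<inter> K\<close> because this set
  is compact and so bounds \<open>f\<close>; \<open>\<Omega> \<inter> K\<close> itself need not be
  closed.\<close>

lemma set_integrable_continuous_Int_compact:
  fixes f :: "'a::euclidean_space \<Rightarrow> real"
  assumes \<Omega>: "open \<Omega>" and K: "compact K" and f: "continuous_on (closure \<Omega> \<inter> K) f"
  shows "set_integrable lebesgue (\<Omega> \<inter> K) f"
proof -
  have c: "compact (closure \<Omega> \<inter> K)" using K by (simp add: closed_Int_compact)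
  then obtain B where B: "\<And>x. x \<in> closure \<Omega> \<inter> K \<Longrightarrow> \<bar>f x\<bar> \<le> B"
    using compact_continuous_abs_bound f by blast
  have S: "\<Omega> \<inter> K \<in> sets borel"
    using \<Omega> K by (intro sets.Int borel_open borel_closed compact_imp_closed)
  have "emeasure lborel (\<Omega> \<inter> K) < \<infinity>"
    by (rule emeasure_bounded_finite) (use K compact_imp_bounded in auto)
  then have "set_integrable lebesgue (\<Omega> \<inter> K) (\<lambda>x. 1)"
    using S by (simp add: set_integrable_def integrable_indicator_iff emeasure_completion)
  then have "set_integrable lebesgue (\<Omega> \<inter> K) (\<lambda>x. f x * 1)"
    by (rule set_integrable_continuous_mult[where B = B, rotated 3])
       (use S f B closure_subset[of \<Omega>] in \<open>auto elim!: continuous_on_subset\<close>)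
  then show ?thesis by simp
qed

text \<open>Convergence is assumed at every point of \<open>A\<close>, so that measurability of the
  limit follows from that of the terms.\<close>

lemma set_integral_dominated_convergence:
  fixes f :: "nat \<Rightarrow> 'a \<Rightarrow> real"
  assumes f: "\<And>n. set_integrable M A (f n)" and w: "set_integrable M A w"
    and lim: "\<And>x. x \<in> A \<Longrightarrow> (\<lambda>n. f n x) \<longlonglongrightarrow> g x"
    and bound: "\<And>n x. x \<in> A \<Longrightarrow> \<bar>f n x\<bar> \<le> w x"
  shows "set_integrable M A g" "(\<lambda>n. LINT x:A|M. f n x) \<longlonglongrightarrow> (LINT x:A|M. g x)"
proof -
  have m: "(\<lambda>x. indicator A x *\<^sub>R f n x) \<in> borel_measurable M" for n
    using f by (auto simp: set_integrable_def)
  have l: "(\<lambda>n. indicator A x *\<^sub>R f n x) \<longlonglongrightarrow> indicator A x *\<^sub>R g x" for x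
    using lim by (cases "x \<in> A") auto
  have mg: "(\<lambda>x. indicator A x *\<^sub>R g x) \<in> borel_measurable M"
    by (rule borel_measurable_LIMSEQ_real[OF l m])
  have b: "norm (indicator A x *\<^sub>R f n x) \<le> indicator A x *\<^sub>R w x" for n x
    using bound by (cases "x \<in> A") auto
  show "set_integrable M A g" "(\<lambda>n. LINT x:A|M. f n x) \<longlonglongrightarrow> (LINT x:A|M. g x)"
    unfolding set_integrable_def set_lebesgue_integral_def
    using integrable_dominated_convergence[OF mg m w[unfolded set_integrable_def] AE_I2 AE_I2, OF l b]
      integral_dominated_convergence[OF mg m w[unfolded set_integrable_def] AE_I2 AE_I2, OF l b]
    by simp_all
qed


section \<open>Partial derivatives\<close>

lemma partial_eqI:
  "((\<lambda>t. f (x + t *\<^sub>R axis i 1)) has_real_derivative D) (at 0) \<Longrightarrow> partial i f x = D"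
  unfolding partial_def by (rule DERIV_imp_deriv)

lemma has_partial:
  assumes "(\<lambda>t. f (x + t *\<^sub>R axis i 1)) differentiable (at 0)"
  shows "((\<lambda>t. f (x + t *\<^sub>R axis i 1)) has_real_derivative partial i f x) (at 0)"
  using assms unfolding partial_def by (metis DERIV_deriv_iff_real_differentiable)

text \<open>\<open>partial\<close> at \<open>x\<close> sees only a short piece of a line through
  \<open>x\<close>, which stays in the open set. Hence a test function, prescribed on \<Omega>
  alone, has a well-determined gradient there.\<close>

lemma partial_cong_open:
  assumes "open S" "x \<in> S" "\<And>y. y \<in> S \<Longrightarrow> f y = g y"
  shows "partial i f x = partial i g x"
  unfolding partial_def
proof (rule deriv_cong_ev)
  have "((\<lambda>t. x + t *\<^sub>R axis i 1) \<longlongrightarrow> x + 0 *\<^sub>R axis i (1::real)) (nhds 0)"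
    by (intro tendsto_intros) (simp add: filterlim_ident)
  then have "\<forall>\<^sub>F t in nhds 0. x + t *\<^sub>R axis i 1 \<in> S"
    using assms(1,2) by (auto dest: topological_tendstoD)
  then show "\<forall>\<^sub>F t in nhds 0. f (x + t *\<^sub>R axis i 1) = g (x + t *\<^sub>R axis i 1)"
    by eventually_elim (use assms(3) in auto)
qed simp

lemma grad_cong_open:
  "open S \<Longrightarrow> x \<in> S \<Longrightarrow> (\<And>y. y \<in> S \<Longrightarrow> f y = g y) \<Longrightarrow> grad f x = grad g x"
  unfolding grad_def using partial_cong_open[of S x f g] by (simp add: vec_eq_iff)

lemma partial_const [simp]: "partial i (\<lambda>_. c) x = 0"
  by (rule partial_eqI) simp

lemma grad_const [simp]: "grad (\<lambda>_. c) x = 0"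
  by (simp add: grad_def vec_eq_iff)

text \<open>\<open>partial\<close> takes a derivative at parameter 0 only; recentring the line at
  the point with parameter \<open>t\<close> gives the derivative along a whole segment, as a
  Lipschitz bound requires.\<close>

lemma differentiable_along_axis:
  assumes "\<And>x. f differentiable (at x)"
  shows "((\<lambda>t. f (x + t *\<^sub>R axis i 1)) has_real_derivative partial i f (x + t *\<^sub>R axis i 1)) (at t)"
proof -
  have "(\<lambda>s. f (y + s *\<^sub>R axis i 1)) differentiable (at 0)" for y
  proof -
    have "(f \<circ> (\<lambda>s. y + s *\<^sub>R axis i 1)) differentiable (at 0)"
      using assms by (intro differentiable_chain_at) (auto intro!: derivative_intros)
    then show ?thesis by (simp add: o_def)
  qed
  from has_partial[OF this, of "x + t *\<^sub>R axis i 1"]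
  have "((\<lambda>s. f (x + (t + s) *\<^sub>R axis i 1)) has_real_derivative partial i f (x + t *\<^sub>R axis i 1)) (at 0)"
    by (simp add: algebra_simps)
  then show ?thesis
    using DERIV_at_within_shift[of "\<lambda>s. f (x + s *\<^sub>R axis i 1)" _ t 0 UNIV] by (simp add: surj_plus)
qed

lemma C_k_1_iff: "C_k 1 f \<longleftrightarrow> (\<forall>x. f differentiable (at x)) \<and> (\<forall>i. continuous_on UNIV (partial i f))"
  by (simp add: One_nat_def)

lemma continuous_on_C_k_1: "C_k 1 f \<Longrightarrow> continuous_on S f"
  unfolding C_k_1_iff by (auto intro!: continuous_at_imp_continuous_on differentiable_imp_continuous_within)

lemma continuous_on_grad: "C_k 1 f \<Longrightarrow> continuous_on S (grad f)"
  unfolding C_k_1_iff grad_def by (auto intro!: continuous_intros intro: continuous_on_subset)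

lemma partial_compose:
  assumes h: "\<And>t. (h has_real_derivative h' t) (at t)" and f: "C_k 1 f"
  shows "partial i (\<lambda>x. h (f x)) x = h' (f x) * partial i f x"
proof (rule partial_eqI)
  have "((\<lambda>t. f (x + t *\<^sub>R axis i 1)) has_real_derivative partial i f x) (at 0)"
    using differentiable_along_axis[of f x i 0] f unfolding C_k_1_iff by auto
  then show "((\<lambda>t. h (f (x + t *\<^sub>R axis i 1))) has_real_derivative h' (f x) * partial i f x) (at 0)"
    by (rule DERIV_chain2[rotated]) (use h in simp)
qed

lemma C_k_1_compose:
  assumes h: "\<And>t. (h has_real_derivative h' t) (at t)" "continuous_on UNIV h'" and f: "C_k 1 f"
  shows "C_k 1 (\<lambda>x. h (f x))"
  unfolding C_k_1_iff
proof (intro conjI allI)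
  fix x
  have "h differentiable (at (f x))" using h(1) real_differentiable_def by blast
  then show "(\<lambda>x. h (f x)) differentiable (at x)"
    using f differentiable_chain_at[of f x h] by (simp add: o_def C_k_1_iff)
next
  fix i
  have "continuous_on UNIV (\<lambda>x. h' (f x) * partial i f x)"
    using f h(2) continuous_on_C_k_1[OF f, of UNIV]
    by (intro continuous_on_mult continuous_on_compose2[OF h(2)]) (auto simp: C_k_1_iff)
  then show "continuous_on UNIV (partial i (\<lambda>x. h (f x)))"
    using partial_compose[OF h(1) f, of i] by (simp add: fun_eq_iff[symmetric] cong: continuous_on_cong)
qed


section \<open>Absolutely continuous functions\<close>

lemma abs_cont_on_interval_lipschitz:
  assumes L: "\<And>s t. a \<le> s \<Longrightarrow> s \<le> t \<Longrightarrow> t \<le> b \<Longrightarrow> \<bar>f t - f s\<bar> \<le> L * (t - s)"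
  shows "abs_cont_on_interval a b f"
  unfolding abs_cont_on_interval_def
proof (intro allI impI)
  fix \<epsilon> :: real assume \<epsilon>: "\<epsilon> > 0"
  \<comment> \<open>The added 1 keeps the denominator positive even if \<open>L\<close> is
    0.\<close>
  let ?\<delta> = "\<epsilon> / (\<bar>L\<bar> + 1)"
  have "(\<Sum>j<n. \<bar>f (t j) - f (s j)\<bar>) < \<epsilon>"
    if st: "\<forall>j<n. a \<le> s j \<and> s j \<le> t j \<and> t j \<le> b" and sm: "(\<Sum>j<n. t j - s j) < ?\<delta>"
    for n :: nat and s t
  proof -
    have "(\<Sum>j<n. \<bar>f (t j) - f (s j)\<bar>) \<le> (\<Sum>j<n. (\<bar>L\<bar> + 1) * (t j - s j))"
    proof (rule sum_mono)
      fix j assume "j \<in> {..<n}"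
      then have j: "a \<le> s j" "s j \<le> t j" "t j \<le> b" using st by auto
      have "\<bar>f (t j) - f (s j)\<bar> \<le> L * (t j - s j)" using L j by blast
      also have "\<dots> \<le> (\<bar>L\<bar> + 1) * (t j - s j)" using j by (intro mult_right_mono) auto
      finally show "\<bar>f (t j) - f (s j)\<bar> \<le> (\<bar>L\<bar> + 1) * (t j - s j)" .
    qed
    also have "\<dots> = (\<bar>L\<bar> + 1) * (\<Sum>j<n. t j - s j)" by (simp add: sum_distrib_left)
    also have "\<dots> < \<epsilon>" using sm by (simp add: field_simps)
    finally show ?thesis .
  qed
  then show "\<exists>\<delta>>0. \<forall>(n::nat) s t.
        (\<forall>j<n. a \<le> s j \<and> s j \<le> t j \<and> t j \<le> b) \<and> (\<forall>j. Suc j < n \<longrightarrow> t j \<le> s (Suc j)) \<and>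
        (\<Sum>j<n. t j - s j) < \<delta> \<longrightarrow> (\<Sum>j<n. \<bar>f (t j) - f (s j)\<bar>) < \<epsilon>"
    using \<epsilon> by (intro exI[of _ ?\<delta>]) auto
qed

text \<open>One criterion serves sums and products: once the increments of \<open>F\<close> are
  controlled by those of \<open>f\<close> and \<open>g\<close>, each of the two receives half of the
  tolerance, scaled by the constant.\<close>

lemma abs_cont_on_interval_dominated:
  assumes f: "abs_cont_on_interval a b f" and g: "abs_cont_on_interval a b g"
    and F: "\<And>s t. a \<le> s \<Longrightarrow> s \<le> t \<Longrightarrow> t \<le> b \<Longrightarrow>
      \<bar>F t - F s\<bar> \<le> B * (\<bar>f t - f s\<bar> + \<bar>g t - g s\<bar>)"
  shows "abs_cont_on_interval a b F"
  unfolding abs_cont_on_interval_def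
proof (intro allI impI)
  fix \<epsilon> :: real assume \<epsilon>: "\<epsilon> > 0"
  define C where "C = \<bar>B\<bar> + 1"
  have C: "C > 0" "B \<le> C" by (auto simp: C_def)
  let ?\<epsilon>' = "\<epsilon> / (2 * C)"
  have \<epsilon>': "?\<epsilon>' > 0" using \<epsilon> C by simp
  let ?P = "\<lambda>f \<delta> \<epsilon>. \<forall>(n::nat) s t.
        (\<forall>j<n. a \<le> s j \<and> s j \<le> t j \<and> t j \<le> b) \<and> (\<forall>j. Suc j < n \<longrightarrow> t j \<le> s (Suc j)) \<and>
        (\<Sum>j<n. t j - s j) < \<delta> \<longrightarrow> (\<Sum>j<n. \<bar>f (t j) - f (s j) :: real\<bar>) < \<epsilon>"
  obtain \<delta>1 where \<delta>1: "\<delta>1 > 0" "?P f \<delta>1 ?\<epsilon>'"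
    using f[unfolded abs_cont_on_interval_def, rule_format, OF \<epsilon>'] by auto
  obtain \<delta>2 where \<delta>2: "\<delta>2 > 0" "?P g \<delta>2 ?\<epsilon>'"
    using g[unfolded abs_cont_on_interval_def, rule_format, OF \<epsilon>'] by auto
  have "(\<Sum>j<n. \<bar>F (t j) - F (s j)\<bar>) < \<epsilon>"
    if st: "\<forall>j<n. a \<le> s j \<and> s j \<le> t j \<and> t j \<le> b" "\<forall>j. Suc j < n \<longrightarrow> t j \<le> s (Suc j)"
      and sm: "(\<Sum>j<n. t j - s j) < min \<delta>1 \<delta>2"
    for n :: nat and s t
  proof -
    have "(\<Sum>j<n. \<bar>F (t j) - F (s j)\<bar>)
        \<le> (\<Sum>j<n. C * (\<bar>f (t j) - f (s j)\<bar> + \<bar>g (t j) - g (s j)\<bar>))"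
    proof (rule sum_mono)
      fix j assume "j \<in> {..<n}"
      then have "\<bar>F (t j) - F (s j)\<bar> \<le> B * (\<bar>f (t j) - f (s j)\<bar> + \<bar>g (t j) - g (s j)\<bar>)"
        using F st by auto
      also have "\<dots> \<le> C * (\<bar>f (t j) - f (s j)\<bar> + \<bar>g (t j) - g (s j)\<bar>)"
        using C by (intro mult_right_mono) auto
      finally show "\<bar>F (t j) - F (s j)\<bar> \<le> C * (\<bar>f (t j) - f (s j)\<bar> + \<bar>g (t j) - g (s j)\<bar>)" .
    qed
    also have "\<dots> = C * ((\<Sum>j<n. \<bar>f (t j) - f (s j)\<bar>) + (\<Sum>j<n. \<bar>g (t j) - g (s j)\<bar>))"
      by (simp add: sum_distrib_left sum.distrib distrib_left)
    also have "\<dots> < C * (?\<epsilon>' + ?\<epsilon>')"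
      using C st sm \<delta>1(2)[rule_format, of n s t] \<delta>2(2)[rule_format, of n s t]
      by (intro mult_strict_left_mono add_strict_mono) auto
    also have "\<dots> = \<epsilon>" using C by (simp add: field_simps)
    finally show ?thesis .
  qed
  then show "\<exists>\<delta>>0. ?P F \<delta> \<epsilon>"
    using \<delta>1(1) \<delta>2(1) by (intro exI[of _ "min \<delta>1 \<delta>2"]) auto
qed

lemma abs_cont_on_interval_add:
  assumes "abs_cont_on_interval a b f" "abs_cont_on_interval a b g"
  shows "abs_cont_on_interval a b (\<lambda>t. f t + g t)"
  by (rule abs_cont_on_interval_dominated[where B = 1, OF assms]) auto

lemma abs_cont_on_interval_mult:
  assumes "abs_cont_on_interval a b f" "abs_cont_on_interval a b g"
    and c: "continuous_on {a..b} f" "continuous_on {a..b} g"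
  shows "abs_cont_on_interval a b (\<lambda>t. f t * g t)"
proof -
  obtain B1 where B1: "\<And>t. t \<in> {a..b} \<Longrightarrow> \<bar>f t\<bar> \<le> B1"
    using compact_continuous_abs_bound[OF compact_Icc c(1)] by blast
  obtain B2 where B2: "\<And>t. t \<in> {a..b} \<Longrightarrow> \<bar>g t\<bar> \<le> B2"
    using compact_continuous_abs_bound[OF compact_Icc c(2)] by blast
  show ?thesis
  proof (rule abs_cont_on_interval_dominated[where B = "max B1 B2", OF assms(1,2)])
    fix s t assume st: "a \<le> s" "s \<le> t" "t \<le> b"
    have "f t * g t - f s * g s = f t * (g t - g s) + g s * (f t - f s)" by (simp add: algebra_simps)
    then have "\<bar>f t * g t - f s * g s\<bar> \<le> \<bar>f t\<bar> * \<bar>g t - g s\<bar> + \<bar>g s\<bar> * \<bar>f t - f s\<bar>"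
      by (metis abs_mult abs_triangle_ineq)
    also have "\<dots> \<le> max B1 B2 * \<bar>g t - g s\<bar> + max B1 B2 * \<bar>f t - f s\<bar>"
      using st B1[of t] B2[of s] by (intro add_mono mult_right_mono) auto
    finally show "\<bar>f t * g t - f s * g s\<bar> \<le> max B1 B2 * (\<bar>f t - f s\<bar> + \<bar>g t - g s\<bar>)"
      by (simp add: algebra_simps)
  qed
qed

section \<open>Sums, products and localisation of absolutely continuous functions on a
  domain\<close>

lemma abs_contD:
  assumes "abs_cont \<Omega> \<Gamma> f"
  shows abs_cont_continuous: "continuous_on (closure \<Omega> - \<Gamma>) f"
    and abs_cont_segments: "AE x in lebesgue. \<forall>a b. a \<le> b \<and> (\<forall>t\<in>{a..b}. x + t *\<^sub>R axis i 1 \<in> \<Omega>) \<longrightarrow>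
             abs_cont_on_interval a b (\<lambda>t. f (x + t *\<^sub>R axis i 1))"
    and abs_cont_differentiable:
      "AE x in lebesgue. x \<in> \<Omega> \<longrightarrow> (\<lambda>t. f (x + t *\<^sub>R axis i 1)) differentiable (at 0)"
    and abs_cont_integrable:
      "compact K \<Longrightarrow> K \<inter> \<Gamma> = {} \<Longrightarrow> set_integrable lebesgue (\<Omega> \<inter> K) (partial i f)"
  using assms unfolding abs_cont_def by auto

text \<open>Where \<open>f\<close> or \<open>g\<close> has no derivative along the axis,
  \<open>partial\<close> is an unspecified value of \<open>deriv\<close> and additivity may fail;
  within \<Omega> these points form a null set.\<close>

lemma partial_add_AE:
  assumes "abs_cont \<Omega> \<Gamma> f" "abs_cont \<Omega> \<Gamma> g"
  shows "AE x in lebesgue. x \<in> \<Omega> \<longrightarrow> partial i (\<lambda>y. f y + g y) x = partial i f x + partial i g x"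
  using assms[THEN abs_cont_differentiable, of i]
  by eventually_elim (auto intro!: partial_eqI DERIV_add has_partial)

lemma partial_mult_AE:
  assumes "abs_cont \<Omega> \<Gamma> f" "abs_cont \<Omega> \<Gamma> g"
  shows "AE x in lebesgue. x \<in> \<Omega> \<longrightarrow>
    partial i (\<lambda>y. f y * g y) x = f x * partial i g x + g x * partial i f x"
  using assms[THEN abs_cont_differentiable, of i]
proof eventually_elim
  fix x
  assume *: "x \<in> \<Omega> \<longrightarrow> (\<lambda>t. f (x + t *\<^sub>R axis i 1)) differentiable (at 0)"
    "x \<in> \<Omega> \<longrightarrow> (\<lambda>t. g (x + t *\<^sub>R axis i 1)) differentiable (at 0)"
  show "x \<in> \<Omega> \<longrightarrow> partial i (\<lambda>y. f y * g y) x = f x * partial i g x + g x * partial i f x"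
  proof
    assume "x \<in> \<Omega>"
    with * have "((\<lambda>t. f (x + t *\<^sub>R axis i 1) * g (x + t *\<^sub>R axis i 1)) has_real_derivative
        partial i f x * g (x + 0 *\<^sub>R axis i 1) + partial i g x * f (x + 0 *\<^sub>R axis i 1)) (at 0)"
      by (intro DERIV_mult has_partial) auto
    then show "partial i (\<lambda>y. f y * g y) x = f x * partial i g x + g x * partial i f x"
      by (intro partial_eqI) (simp add: algebra_simps)
  qed
qed

lemma abs_cont_add:
  assumes f: "abs_cont \<Omega> \<Gamma> f" and g: "abs_cont \<Omega> \<Gamma> g"
  shows "abs_cont \<Omega> \<Gamma> (\<lambda>x. f x + g x)"
  unfolding abs_cont_def
proof (intro conjI allI impI)
  show "continuous_on (closure \<Omega> - \<Gamma>) (\<lambda>x. f x + g x)"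
    using f g by (intro continuous_on_add abs_cont_continuous)
next
  fix i
  show "AE x in lebesgue. \<forall>a b. a \<le> b \<and> (\<forall>t\<in>{a..b}. x + t *\<^sub>R axis i 1 \<in> \<Omega>) \<longrightarrow>
      abs_cont_on_interval a b (\<lambda>t. f (x + t *\<^sub>R axis i 1) + g (x + t *\<^sub>R axis i 1))"
    using f[THEN abs_cont_segments, of i] g[THEN abs_cont_segments, of i]
    by eventually_elim (auto intro!: abs_cont_on_interval_add)
  show "AE x in lebesgue. x \<in> \<Omega> \<longrightarrow>
      (\<lambda>t. f (x + t *\<^sub>R axis i 1) + g (x + t *\<^sub>R axis i 1)) differentiable (at 0)"
    using f[THEN abs_cont_differentiable, of i] g[THEN abs_cont_differentiable, of i]
    by eventually_elim auto
  fix K :: "(real^'a) set" assume K: "compact K \<and> K \<inter> \<Gamma> = {}"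
  show "set_integrable lebesgue (\<Omega> \<inter> K) (partial i (\<lambda>x. f x + g x))"
  proof (rule set_integrable_lebesgue_cong_AE)
    show "set_integrable lebesgue (\<Omega> \<inter> K) (\<lambda>x. partial i f x + partial i g x)"
      using K f g by (intro set_integral_add abs_cont_integrable) auto
    show "AE x in lebesgue. x \<in> \<Omega> \<inter> K \<longrightarrow>
        partial i f x + partial i g x = partial i (\<lambda>x. f x + g x) x"
      using partial_add_AE[OF f g, of i] by eventually_elim auto
  qed
qed

text \<open>A product needs bounded factors, in two places. On a segment in \<Omega> both factors
  are continuous because \<Omega> avoids \<Gamma>. On a compact \<open>K\<close> off \<Gamma> both
  are bounded on the compact set \<open>closure \<Omega> \<inter> K\<close>, so each of the two
  terms of the product rule is integrable.\<close>

lemma abs_cont_mult: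
  assumes \<Omega>: "open \<Omega>" "\<Omega> \<inter> \<Gamma> = {}" and f: "abs_cont \<Omega> \<Gamma> f" and g: "abs_cont \<Omega> \<Gamma> g"
  shows "abs_cont \<Omega> \<Gamma> (\<lambda>x. f x * g x)"
  unfolding abs_cont_def
proof (intro conjI allI impI)
  show "continuous_on (closure \<Omega> - \<Gamma>) (\<lambda>x. f x * g x)"
    using f g by (intro continuous_on_mult abs_cont_continuous)
next
  fix i
  have seg: "continuous_on {a..b} (\<lambda>t. F (x + t *\<^sub>R axis i 1))"
    if "abs_cont \<Omega> \<Gamma> F" "\<forall>t\<in>{a..b}. x + t *\<^sub>R axis i 1 \<in> \<Omega>" for F x a b
    using that(2) \<Omega>(2) closure_subset[of \<Omega>]
    by (intro continuous_on_compose2[OF abs_cont_continuous[OF that(1)]]) (auto intro!: continuous_intros)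
  show "AE x in lebesgue. \<forall>a b. a \<le> b \<and> (\<forall>t\<in>{a..b}. x + t *\<^sub>R axis i 1 \<in> \<Omega>) \<longrightarrow>
      abs_cont_on_interval a b (\<lambda>t. f (x + t *\<^sub>R axis i 1) * g (x + t *\<^sub>R axis i 1))"
    using f[THEN abs_cont_segments, of i] g[THEN abs_cont_segments, of i]
    by eventually_elim (intro allI impI abs_cont_on_interval_mult seg f g; simp)
  show "AE x in lebesgue. x \<in> \<Omega> \<longrightarrow>
      (\<lambda>t. f (x + t *\<^sub>R axis i 1) * g (x + t *\<^sub>R axis i 1)) differentiable (at 0)"
    using f[THEN abs_cont_differentiable, of i] g[THEN abs_cont_differentiable, of i]
    by eventually_elim auto
  fix K :: "(real^'a) set" assume K: "compact K \<and> K \<inter> \<Gamma> = {}"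
  have prod: "set_integrable lebesgue (\<Omega> \<inter> K) (\<lambda>x. F x * partial i G x)"
    if F: "abs_cont \<Omega> \<Gamma> F" and G: "abs_cont \<Omega> \<Gamma> G" for F G
  proof -
    have c: "continuous_on (closure \<Omega> \<inter> K) F"
      using K by (intro continuous_on_subset[OF abs_cont_continuous[OF F]]) auto
    have "compact (closure \<Omega> \<inter> K)" using K by (simp add: closed_Int_compact)
    then obtain B where B: "\<And>x. x \<in> closure \<Omega> \<inter> K \<Longrightarrow> \<bar>F x\<bar> \<le> B"
      using compact_continuous_abs_bound c by blast
    show ?thesis
    proof (rule set_integrable_continuous_mult)
      show "\<Omega> \<inter> K \<in> sets borel"
        using \<Omega> K by (intro sets.Int borel_open borel_closed compact_imp_closed) auto
      show "continuous_on (\<Omega> \<inter> K) F"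
        using closure_subset[of \<Omega>] by (intro continuous_on_subset[OF c]) auto
      show "\<bar>F x\<bar> \<le> B" if "x \<in> \<Omega> \<inter> K" for x
        using that B closure_subset[of \<Omega>] by auto
      show "set_integrable lebesgue (\<Omega> \<inter> K) (partial i G)"
        using abs_cont_integrable[OF G] K by auto
    qed
  qed
  show "set_integrable lebesgue (\<Omega> \<inter> K) (partial i (\<lambda>x. f x * g x))"
  proof (rule set_integrable_lebesgue_cong_AE)
    show "set_integrable lebesgue (\<Omega> \<inter> K) (\<lambda>x. f x * partial i g x + g x * partial i f x)"
      using f g by (intro set_integral_add prod)
    show "AE x in lebesgue. x \<in> \<Omega> \<inter> K \<longrightarrow>
        f x * partial i g x + g x * partial i f x = partial i (\<lambda>x. f x * g x) x"
      using partial_mult_AE[OF f g, of i] by eventually_elim auto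
  qed
qed

text \<open>A continuous partial derivative is bounded along a compact segment, so the mean value
  inequality makes \<open>f\<close> Lipschitz there.\<close>

lemma abs_cont_C_k_1:
  assumes \<Omega>: "open \<Omega>" and f: "C_k 1 f"
  shows "abs_cont \<Omega> \<Gamma> f"
  unfolding abs_cont_def
proof (intro conjI allI impI AE_I2)
  show "continuous_on (closure \<Omega> - \<Gamma>) f" using f by (rule continuous_on_C_k_1)
next
  fix i and x :: "real^'a"
  have d: "((\<lambda>t. f (x + t *\<^sub>R axis i 1)) has_real_derivative partial i f (x + t *\<^sub>R axis i 1)) (at t)" for t
    using f by (intro differentiable_along_axis) (auto simp: C_k_1_iff)
  show "(\<lambda>t. f (x + t *\<^sub>R axis i 1)) differentiable (at 0)"
    using d real_differentiable_def by blast
  have pc: "continuous_on S (partial i f)" for S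
    using f unfolding C_k_1_iff by (blast intro: continuous_on_subset[of UNIV])
  fix a b :: real assume "a \<le> b \<and> (\<forall>t\<in>{a..b}. x + t *\<^sub>R axis i 1 \<in> \<Omega>)"
  have "continuous_on {a..b} (\<lambda>t. partial i f (x + t *\<^sub>R axis i 1))"
    by (intro continuous_on_compose2[OF pc[of UNIV]]) (auto intro!: continuous_intros)
  then obtain L where L: "\<And>t. t \<in> {a..b} \<Longrightarrow> \<bar>partial i f (x + t *\<^sub>R axis i 1)\<bar> \<le> L"
    using compact_continuous_abs_bound[OF compact_Icc] by blast
  show "abs_cont_on_interval a b (\<lambda>t. f (x + t *\<^sub>R axis i 1))"
  proof (rule abs_cont_on_interval_lipschitz)
    fix s t assume st: "a \<le> s" "s \<le> t" "t \<le> b"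
    have "norm (f (x + t *\<^sub>R axis i 1) - f (x + s *\<^sub>R axis i 1)) \<le> L * norm (t - s)"
    proof (rule field_differentiable_bound)
      show "convex {s..t}" by simp
      show "((\<lambda>t. f (x + t *\<^sub>R axis i 1)) has_real_derivative partial i f (x + r *\<^sub>R axis i 1)) (at r within {s..t})" for r
        by (rule has_field_derivative_at_within[OF d])
    qed (use st L in auto)
    then show "\<bar>f (x + t *\<^sub>R axis i 1) - f (x + s *\<^sub>R axis i 1)\<bar> \<le> L * (t - s)" using st by simp
  qed
next
  fix i and K :: "(real^'a) set" assume "compact K \<and> K \<inter> \<Gamma> = {}"
  then show "set_integrable lebesgue (\<Omega> \<inter> K) (partial i f)"
    using f by (intro set_integrable_continuous_Int_compact \<Omega>)
      (auto simp: C_k_1_iff intro: continuous_on_subset)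
qed

lemma abs_cont_const: "open \<Omega> \<Longrightarrow> abs_cont \<Omega> \<Gamma> (\<lambda>_. c)"
  by (rule abs_cont_C_k_1) (auto simp: C_k_1_iff partial_const[abs_def])

lemma abs_cont_sum:
  assumes "open \<Omega>" "\<And>j. j \<in> J \<Longrightarrow> abs_cont \<Omega> \<Gamma> (f j)"
  shows "abs_cont \<Omega> \<Gamma> (\<lambda>x. \<Sum>j\<in>J. f j x)"
  using assms(2)
  by (induction J rule: infinite_finite_induct) (auto intro!: abs_cont_add abs_cont_const assms(1))

text \<open>This removes the exemption of \<Gamma>. In the application \<open>K\<close> is the
  support of a test function and \<open>Z\<close> its zero set: both are closed, which gluing
  continuity demands, and they may overlap.\<close>

lemma abs_cont_extend_by_zero:
  assumes f: "abs_cont \<Omega> \<Gamma> f" and K: "compact K" "K \<inter> \<Gamma> = {}"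
    and Z: "closed Z" "K \<union> Z = UNIV" "\<And>x. x \<in> Z \<Longrightarrow> f x = 0"
  shows "abs_cont \<Omega> {} f"
  unfolding abs_cont_def
proof (intro conjI allI impI)
  have "continuous_on ((closure \<Omega> \<inter> K) \<union> (closure \<Omega> \<inter> Z)) f"
  proof (rule continuous_on_closed_Un)
    show "continuous_on (closure \<Omega> \<inter> K) f"
      using K by (intro continuous_on_subset[OF abs_cont_continuous[OF f]]) auto
    show "continuous_on (closure \<Omega> \<inter> Z) f"
      using continuous_on_const[of "closure \<Omega> \<inter> Z" "0::real"] by (rule continuous_on_eq) (use Z(3) in auto)
  qed (use K Z in \<open>auto intro: closed_Int compact_imp_closed\<close>)
  also have "(closure \<Omega> \<inter> K) \<union> (closure \<Omega> \<inter> Z) = closure \<Omega> - {}" using Z(2) by auto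
  finally show "continuous_on (closure \<Omega> - {}) f" .
next
  fix i
  show "AE x in lebesgue. \<forall>a b. a \<le> b \<and> (\<forall>t\<in>{a..b}. x + t *\<^sub>R axis i 1 \<in> \<Omega>) \<longrightarrow>
      abs_cont_on_interval a b (\<lambda>t. f (x + t *\<^sub>R axis i 1))"
    using f by (rule abs_cont_segments)
  show "AE x in lebesgue. x \<in> \<Omega> \<longrightarrow> (\<lambda>t. f (x + t *\<^sub>R axis i 1)) differentiable (at 0)"
    using f by (rule abs_cont_differentiable)
  fix L :: "(real^'a) set" assume L: "compact L \<and> L \<inter> {} = {}"
  have "set_integrable lebesgue (\<Omega> \<inter> (L \<inter> K)) (partial i f)"
    using K L by (intro abs_cont_integrable[OF f]) auto
  \<comment> \<open>The complement of \<open>K\<close> is open and contained in \<open>Z\<close>, so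
    \<open>f\<close> is locally zero there. Integrability on \<open>L\<close> thus reduces to
    \<open>L \<inter> K\<close>, which is compact and misses \<Gamma>.\<close>
  moreover have "partial i f x = 0" if "x \<notin> K" for x
  proof -
    have "partial i f x = partial i (\<lambda>_. 0) x"
      by (rule partial_cong_open[of "- K"]) (use that K Z in \<open>auto simp: compact_imp_closed open_Compl\<close>)
    then show ?thesis by simp
  qed
  ultimately show "set_integrable lebesgue (\<Omega> \<inter> L) (partial i f)"
    using set_integrable_IntD[of lebesgue "\<Omega> \<inter> L" K "partial i f"] by (auto simp: Int_assoc)
qed


section \<open>Green's formula for a composed test function\<close>

lemma Cc_infinityD:
  assumes "\<phi> \<in> Cc_infinity U"
  shows "C_k 1 \<phi>" "compact (closure {x. \<phi> x \<noteq> 0})" "closure {x. \<phi> x \<noteq> 0} \<subseteq> U"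
  using assms by (auto simp: Cc_infinity_def simp del: C_k.simps)

lemma grad_eq_0_outside_support:
  assumes "x \<notin> closure {x. \<phi> x \<noteq> 0}"
  shows "\<phi> x = 0" "grad \<phi> x = 0"
proof -
  show "\<phi> x = 0" using assms closure_subset[of "{x. \<phi> x \<noteq> 0}"] by auto
  have "grad \<phi> x = grad (\<lambda>_. 0) x"
    by (rule grad_cong_open[of "- closure {x. \<phi> x \<noteq> 0}"])
       (use assms closure_subset[of "{x. \<phi> x \<noteq> 0}"] in auto)
  then show "grad \<phi> x = 0" by simp
qed

lemma abs_cont_vec_continuous:
  "abs_cont_vec \<Omega> \<Gamma> W \<Longrightarrow> continuous_on (closure \<Omega> - \<Gamma>) W"
  unfolding abs_cont_vec_def
  using continuous_on_vec_lambda[of "closure \<Omega> - \<Gamma>" "\<lambda>i x. W x $ i"]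
  by (auto dest: abs_cont_continuous)

lemma set_integrable_divergence:
  assumes "abs_cont_vec \<Omega> \<Gamma> W" "compact K" "K \<inter> \<Gamma> = {}"
  shows "set_integrable lebesgue (\<Omega> \<inter> K) (divergence W)"
proof -
  have "set_integrable lebesgue (\<Omega> \<inter> K) (partial i (\<lambda>y. W y $ i))" for i
    using assms by (intro abs_cont_integrable) (auto simp: abs_cont_vec_def)
  then have "integrable lebesgue (\<lambda>x. \<Sum>i\<in>UNIV. indicator (\<Omega> \<inter> K) x *\<^sub>R partial i (\<lambda>y. W y $ i) x)"
    unfolding set_integrable_def by (intro Bochner_Integration.integrable_sum)
  then show ?thesis
    unfolding set_integrable_def divergence_def scaleR_sum_right .
qed

lemma set_integrable_mult_divergence:
  assumes \<Omega>: "open \<Omega>" and W: "abs_cont_vec \<Omega> \<Gamma> W" and K: "compact K" "K \<inter> \<Gamma> = {}"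
    and g: "continuous_on (closure \<Omega> \<inter> K) g"
  shows "set_integrable lebesgue (\<Omega> \<inter> K) (\<lambda>x. g x * divergence W x)"
proof -
  have "compact (closure \<Omega> \<inter> K)" using K by (simp add: closed_Int_compact)
  then obtain B where B: "\<And>x. x \<in> closure \<Omega> \<inter> K \<Longrightarrow> \<bar>g x\<bar> \<le> B"
    using compact_continuous_abs_bound g by blast
  show ?thesis
  proof (rule set_integrable_continuous_mult[where B = B])
    show "\<Omega> \<inter> K \<in> sets borel"
      using \<Omega> K by (intro sets.Int borel_open borel_closed compact_imp_closed)
    show "continuous_on (\<Omega> \<inter> K) g"
      using closure_subset[of \<Omega>] by (intro continuous_on_subset[OF g]) auto
    show "\<bar>g x\<bar> \<le> B" if "x \<in> \<Omega> \<inter> K" for x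
      using B that closure_subset[of \<Omega>] by auto
    show "set_integrable lebesgue (\<Omega> \<inter> K) (divergence W)"
      by (rule set_integrable_divergence[OF W K])
  qed
qed

text \<open>\<open>h 0 = 0\<close> makes the product vanish wherever \<phi> does, and the support of
  \<phi> is a compact set missing \<Gamma>. Singularities of \<open>f\<close> at \<Gamma> are
  thereby cut out.\<close>

lemma abs_cont_compose_mult:
  assumes \<Omega>: "open \<Omega>" "\<Omega> \<inter> \<Gamma> = {}" and f: "abs_cont \<Omega> \<Gamma> f" and \<phi>: "\<phi> \<in> Cc_infinity (- \<Gamma>)"
    and h: "\<And>t. (h has_real_derivative h' t) (at t)" "continuous_on UNIV h'" "h 0 = 0"
  shows "abs_cont \<Omega> {} (\<lambda>x. h (\<phi> x) * f x)"
proof (rule abs_cont_extend_by_zero)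
  note D = Cc_infinityD[OF \<phi>]
  show "abs_cont \<Omega> \<Gamma> (\<lambda>x. h (\<phi> x) * f x)"
    by (intro abs_cont_mult \<Omega> f abs_cont_C_k_1 C_k_1_compose[OF h(1,2)] D)
  show "compact (closure {x. \<phi> x \<noteq> 0})" "closure {x. \<phi> x \<noteq> 0} \<inter> \<Gamma> = {}"
    using D by auto
  show "closed {x. \<phi> x = 0}"
    using continuous_closed_preimage_constant[OF continuous_on_C_k_1[OF D(1)] closed_UNIV, of 0] by simp
  show "closure {x. \<phi> x \<noteq> 0} \<union> {x. \<phi> x = 0} = UNIV"
    using closure_subset[of "{x. \<phi> x \<noteq> 0}"] by auto
qed (use h(3) in auto)

text \<open>The exceptional null set comes from \<open>W\<close> alone, as
  \<open>h (\<phi> x)\<close> is of class C^1; the finitely many coordinates share one null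
  set.\<close>

lemma divergence_compose_mult_AE:
  assumes \<Omega>: "open \<Omega>" and W: "abs_cont_vec \<Omega> \<Gamma> W" and \<phi>: "C_k 1 \<phi>"
    and h: "\<And>t. (h has_real_derivative h' t) (at t)" "continuous_on UNIV h'"
  shows "AE x in lebesgue. x \<in> \<Omega> \<longrightarrow> divergence (\<lambda>y. h (\<phi> y) *\<^sub>R W y) x =
    h (\<phi> x) * divergence W x + h' (\<phi> x) * (W x \<bullet> grad \<phi> x)"
proof -
  have "AE x in lebesgue. \<forall>i\<in>UNIV. x \<in> \<Omega> \<longrightarrow> partial i (\<lambda>y. h (\<phi> y) * W y $ i) x =
      h (\<phi> x) * partial i (\<lambda>y. W y $ i) x + W x $ i * partial i (\<lambda>y. h (\<phi> y)) x"
    using W unfolding abs_cont_vec_def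
    by (intro AE_finite_allI finite_code partial_mult_AE[OF abs_cont_C_k_1[OF \<Omega> C_k_1_compose[OF h \<phi>]]]) auto
  then show ?thesis
  proof eventually_elim
    fix x
    assume *: "\<forall>i\<in>UNIV. x \<in> \<Omega> \<longrightarrow> partial i (\<lambda>y. h (\<phi> y) * W y $ i) x =
      h (\<phi> x) * partial i (\<lambda>y. W y $ i) x + W x $ i * partial i (\<lambda>y. h (\<phi> y)) x"
    show "x \<in> \<Omega> \<longrightarrow> divergence (\<lambda>y. h (\<phi> y) *\<^sub>R W y) x =
        h (\<phi> x) * divergence W x + h' (\<phi> x) * (W x \<bullet> grad \<phi> x)"
      using * by (simp add: divergence_def partial_compose[OF h(1) \<phi>] sum.distrib sum_distrib_left
          inner_vec_def grad_def algebra_simps)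
  qed
qed

text \<open>With the field V = h(\<phi>) W, gradient terms arise from two sources: div V contributes
  the weight \<phi> h'(\<phi>), and V . grad \<phi> contributes h(\<phi>). Together they form the
  derivative of t h(t) at t = \<phi>.\<close>

lemma green_compose:
  fixes \<Omega> \<Gamma>\<^sub>D \<Gamma>\<^sub>N :: "(real^'n) set"
  assumes \<Omega>: "open \<Omega>" "\<Omega> \<inter> \<Gamma>\<^sub>D = {}" and green: "greens_formula_valid \<Omega> \<Gamma>\<^sub>D \<Gamma>\<^sub>N"
    and W: "abs_cont_vec \<Omega> \<Gamma>\<^sub>D W" and \<phi>: "\<phi> \<in> Cc_infinity (- \<Gamma>\<^sub>D)"
    and h: "\<And>t. (h has_real_derivative h' t) (at t)" "continuous_on UNIV h'" "h 0 = 0"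
  shows "(LINT x:\<Omega>|lebesgue. \<phi> x * h (\<phi> x) * divergence W x) =
    (LINT x:\<Gamma>\<^sub>N|surface_measure. \<phi> x * h (\<phi> x) * (W x \<bullet> outward_normal \<Omega> x)) -
    (LINT x:\<Omega>|lebesgue. (h (\<phi> x) + \<phi> x * h' (\<phi> x)) * (W x \<bullet> grad \<phi> x))"
    and "set_integrable lebesgue \<Omega> (\<lambda>x. \<phi> x * h (\<phi> x) * divergence W x)"
    and "set_integrable lebesgue \<Omega> (\<lambda>x. (h (\<phi> x) + \<phi> x * h' (\<phi> x)) * (W x \<bullet> grad \<phi> x))"
proof -
  define V where "V x = h (\<phi> x) *\<^sub>R W x" for x
  define K where "K = closure {x. \<phi> x \<noteq> 0}"
  note D = Cc_infinityD[OF \<phi>]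
  have K: "compact K" "K \<inter> \<Gamma>\<^sub>D = {}" using D by (auto simp: K_def)
  have off: "\<phi> x = 0" "grad \<phi> x = 0" if "x \<notin> K" for x
    using grad_eq_0_outside_support[of x \<phi>] that by (auto simp: K_def)
  have c\<phi>: "continuous_on S \<phi>" and cg: "continuous_on S (grad \<phi>)" for S
    using D(1) by (auto intro: continuous_on_C_k_1 continuous_on_grad)
  have ch: "continuous_on S (\<lambda>x. h (\<phi> x))" for S
    using continuous_on_C_k_1[OF C_k_1_compose[OF h(1,2) D(1)]] .
  have ch': "continuous_on S (\<lambda>x. h' (\<phi> x))" for S
    by (rule continuous_on_compose2[OF h(2) c\<phi>]) auto
  have cW: "continuous_on (closure \<Omega> \<inter> K) W"
    using K by (intro continuous_on_subset[OF abs_cont_vec_continuous[OF W]]) auto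
  have i1: "set_integrable lebesgue \<Omega> (\<lambda>x. \<phi> x * h (\<phi> x) * divergence W x)"
    by (rule set_integrable_IntD[OF set_integrable_mult_divergence[OF \<Omega>(1) W K]])
       (auto simp: off intro!: continuous_on_mult c\<phi> ch)
  \<comment> \<open>Stated for any continuous weight \<open>g\<close>, because three weights occur
    below: \<phi> h'(\<phi>), h(\<phi>) and their sum.\<close>
  have i2: "set_integrable lebesgue \<Omega> (\<lambda>x. g x * (W x \<bullet> grad \<phi> x))"
    if g: "\<And>S. continuous_on S g" for g :: "real^'n \<Rightarrow> real"
    by (rule set_integrable_IntD[OF set_integrable_continuous_Int_compact[OF \<Omega>(1) K(1)]])
       (auto simp: off intro!: continuous_on_mult continuous_on_inner g cW cg)
  have V: "abs_cont_vec \<Omega> {} V"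
    unfolding abs_cont_vec_def V_def
    using abs_cont_compose_mult[OF \<Omega> _ \<phi> h] W by (simp add: abs_cont_vec_def)
  have eq: "AE x in lebesgue. x \<in> \<Omega> \<longrightarrow>
      \<phi> x * h (\<phi> x) * divergence W x + \<phi> x * h' (\<phi> x) * (W x \<bullet> grad \<phi> x) = \<phi> x * divergence V x"
    using divergence_compose_mult_AE[OF \<Omega>(1) W D(1) h(1,2)]
    by eventually_elim (simp add: V_def[abs_def] algebra_simps)
  have i3: "set_integrable lebesgue \<Omega> (\<lambda>x. \<phi> x * h' (\<phi> x) * (W x \<bullet> grad \<phi> x))"
    and i4: "set_integrable lebesgue \<Omega> (\<lambda>x. h (\<phi> x) * (W x \<bullet> grad \<phi> x))"
    by (intro i2 continuous_on_mult c\<phi> ch ch')+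
  have "(LINT x:\<Omega>|lebesgue. \<phi> x * divergence V x) =
      (LINT x:\<Omega>|lebesgue. \<phi> x * h (\<phi> x) * divergence W x) +
      (LINT x:\<Omega>|lebesgue. \<phi> x * h' (\<phi> x) * (W x \<bullet> grad \<phi> x))"
    using set_integrable_lebesgue_cong_AE(2)[OF set_integral_add(1)[OF i1 i3] eq]
      set_integral_add(2)[OF i1 i3] by simp
  moreover have "(LINT x:\<Omega>|lebesgue. \<phi> x * divergence V x) =
      (LINT x:\<Gamma>\<^sub>N|surface_measure. \<phi> x * (V x \<bullet> outward_normal \<Omega> x)) -
      (LINT x:\<Omega>|lebesgue. V x \<bullet> grad \<phi> x)"
    using green \<phi> V unfolding greens_formula_valid_def by blast
  moreover have "(LINT x:\<Omega>|lebesgue. (h (\<phi> x) + \<phi> x * h' (\<phi> x)) * (W x \<bullet> grad \<phi> x)) =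
      (LINT x:\<Omega>|lebesgue. h (\<phi> x) * (W x \<bullet> grad \<phi> x)) +
      (LINT x:\<Omega>|lebesgue. \<phi> x * h' (\<phi> x) * (W x \<bullet> grad \<phi> x))"
    unfolding distrib_right by (rule set_integral_add(2)[OF i4 i3])
  ultimately show "(LINT x:\<Omega>|lebesgue. \<phi> x * h (\<phi> x) * divergence W x) =
    (LINT x:\<Gamma>\<^sub>N|surface_measure. \<phi> x * h (\<phi> x) * (W x \<bullet> outward_normal \<Omega> x)) -
    (LINT x:\<Omega>|lebesgue. (h (\<phi> x) + \<phi> x * h' (\<phi> x)) * (W x \<bullet> grad \<phi> x))"
    by (simp add: V_def mult.assoc)
  show "set_integrable lebesgue \<Omega> (\<lambda>x. \<phi> x * h (\<phi> x) * divergence W x)" by (rule i1)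
  show "set_integrable lebesgue \<Omega> (\<lambda>x. (h (\<phi> x) + \<phi> x * h' (\<phi> x)) * (W x \<bullet> grad \<phi> x))"
    by (intro i2 continuous_on_add continuous_on_mult c\<phi> ch ch')
qed


section \<open>Smooth approximation of the power function\<close>

text \<open>With \<open>e > 0\<close> the base \<open>t\<^sup>2 + e\<close> stays away from 0, where
  a power with exponent p/2 - 1 may fail to be differentiable.\<close>

lemma regularised_power_deriv:
  fixes p e t :: real
  assumes "e > 0"
  shows "((\<lambda>t. t * (t\<^sup>2 + e) powr (p/2 - 1)) has_real_derivative
    (t\<^sup>2 + e) powr (p/2 - 1) + (p - 2) * t\<^sup>2 * (t\<^sup>2 + e) powr (p/2 - 2)) (at t)"
proof -
  have "t\<^sup>2 + e > 0" using assms by (simp add: add_nonneg_pos)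
  then show ?thesis
    by (auto intro!: derivative_eq_intros simp: power2_eq_square field_simps)
qed

lemma continuous_on_regularised_power:
  fixes e r :: real
  assumes "e > 0"
  shows "continuous_on S (\<lambda>t. (t\<^sup>2 + e) powr r)"
proof -
  have "t\<^sup>2 + e \<noteq> 0" for t :: real using assms by (smt (verit) zero_le_power2)
  then show ?thesis by (auto intro!: continuous_intros)
qed

text \<open>Majorants independent of \<open>e\<close>. For p < 2 the power s^(p/2 - 1) is unbounded
  as s tends to 0, so monotonicity in s is available only after the prefactors t have been spent,
  via t^2 \<le> s, on raising the exponent to p/2 or (p - 1)/2, which are positive. The second
  quantity is the derivative of t h(t).\<close>

lemma regularised_power_bounds:
  fixes p e t :: real
  assumes p: "1 < p" and e: "0 < e" "e \<le> 1"
  defines "s \<equiv> t\<^sup>2 + e"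
  shows "\<bar>t * (t * s powr (p/2 - 1))\<bar> \<le> (t\<^sup>2 + 1) powr (p/2)"
    and "\<bar>t * s powr (p/2 - 1) + t * (s powr (p/2 - 1) + (p - 2) * t\<^sup>2 * s powr (p/2 - 2))\<bar>
      \<le> (2 + \<bar>p - 2\<bar>) * (t\<^sup>2 + 1) powr ((p - 1)/2)"
proof -
  have s: "s > 0" "t\<^sup>2 \<le> s" "s \<le> t\<^sup>2 + 1" using e by (auto simp: s_def add_nonneg_pos)
  have "\<bar>t * (t * s powr (p/2 - 1))\<bar> = t\<^sup>2 * s powr (p/2 - 1)"
    by (simp add: abs_mult power2_eq_square flip: mult.assoc)
  also have "\<dots> \<le> s * s powr (p/2 - 1)" using s by (intro mult_right_mono) auto
  also have "\<dots> = s powr (p/2)" using s by (simp add: powr_diff)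
  also have "\<dots> \<le> (t\<^sup>2 + 1) powr (p/2)" using s p by (intro powr_mono2) auto
  finally show "\<bar>t * (t * s powr (p/2 - 1))\<bar> \<le> (t\<^sup>2 + 1) powr (p/2)" .
  have half: "\<bar>t\<bar> * s powr (p/2 - 1) \<le> (t\<^sup>2 + 1) powr ((p - 1)/2)"
  proof -
    have "\<bar>t\<bar> = sqrt (t\<^sup>2)" by simp
    also have "\<dots> \<le> s powr (1/2)" using s by (simp add: powr_half_sqrt del: real_sqrt_abs)
    finally have "\<bar>t\<bar> * s powr (p/2 - 1) \<le> s powr (1/2) * s powr (p/2 - 1)"
      by (intro mult_right_mono) auto
    also have "\<dots> = s powr ((p - 1)/2)" by (simp add: diff_divide_distrib flip: powr_add)
    also have "\<dots> \<le> (t\<^sup>2 + 1) powr ((p - 1)/2)" using s p by (intro powr_mono2) auto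
    finally show ?thesis .
  qed
  \<comment> \<open>The factor t^2 absorbs one power of s, so h' is of the size of s^(p/2 - 1); the
    remaining factor t is then handled by \<open>half\<close>.\<close>
  have "t\<^sup>2 * s powr (p/2 - 2) \<le> s * s powr (p/2 - 2)" using s by (intro mult_right_mono) auto
  also have "\<dots> = s powr (p/2 - 1)"
    using s by (simp add: powr_mult_base)
  finally have q: "t\<^sup>2 * s powr (p/2 - 2) \<le> s powr (p/2 - 1)" .
  have "t * s powr (p/2 - 1) + t * (s powr (p/2 - 1) + (p - 2) * t\<^sup>2 * s powr (p/2 - 2))
      = t * (2 * s powr (p/2 - 1) + (p - 2) * (t\<^sup>2 * s powr (p/2 - 2)))"
    by (simp add: algebra_simps)
  also have "\<bar>\<dots>\<bar> = \<bar>t\<bar> * \<bar>2 * s powr (p/2 - 1) + (p - 2) * (t\<^sup>2 * s powr (p/2 - 2))\<bar>"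
    by (simp add: abs_mult)
  also have "\<dots> \<le> \<bar>t\<bar> * (2 * s powr (p/2 - 1) + \<bar>p - 2\<bar> * s powr (p/2 - 1))"
  proof (intro mult_left_mono order.trans[OF abs_triangle_ineq] add_mono)
    show "\<bar>(p - 2) * (t\<^sup>2 * s powr (p/2 - 2))\<bar> \<le> \<bar>p - 2\<bar> * s powr (p/2 - 1)"
      using mult_left_mono[OF q, of "\<bar>p - 2\<bar>"] by (simp add: abs_mult)
  qed auto
  also have "\<dots> = (2 + \<bar>p - 2\<bar>) * (\<bar>t\<bar> * s powr (p/2 - 1))" by (simp add: algebra_simps)
  also have "\<dots> \<le> (2 + \<bar>p - 2\<bar>) * (t\<^sup>2 + 1) powr ((p - 1)/2)"
    by (intro mult_left_mono half) auto
  finally show "\<bar>t * s powr (p/2 - 1) + t * (s powr (p/2 - 1) + (p - 2) * t\<^sup>2 * s powr (p/2 - 2))\<bar>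
      \<le> (2 + \<bar>p - 2\<bar>) * (t\<^sup>2 + 1) powr ((p - 1)/2)" .
qed

text \<open>The two limits are |t|^p and its derivative in t.\<close>

lemma regularised_power_tendsto:
  fixes p t :: real and e :: "nat \<Rightarrow> real"
  assumes p: "1 < p" and e: "e \<longlonglongrightarrow> 0"
  shows "(\<lambda>n. t * (t * (t\<^sup>2 + e n) powr (p/2 - 1))) \<longlonglongrightarrow> \<bar>t\<bar> powr p"
    and "(\<lambda>n. t * (t\<^sup>2 + e n) powr (p/2 - 1) +
        t * ((t\<^sup>2 + e n) powr (p/2 - 1) + (p - 2) * t\<^sup>2 * (t\<^sup>2 + e n) powr (p/2 - 2)))
      \<longlonglongrightarrow> p * t * \<bar>t\<bar> powr (p - 2)"
proof -
  have lim: "(\<lambda>n. (t\<^sup>2 + e n) powr r) \<longlonglongrightarrow> \<bar>t\<bar> powr (2 * r)" if "t \<noteq> 0" for r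
  proof -
    have "(\<lambda>n. (t\<^sup>2 + e n) powr r) \<longlonglongrightarrow> (t\<^sup>2 + 0) powr r"
      using that by (intro tendsto_intros e) auto
    moreover have "(t\<^sup>2 + 0) powr r = \<bar>t\<bar> powr (2 * r)"
    proof -
      have "t\<^sup>2 = \<bar>t\<bar> powr 2" using that by simp
      then show ?thesis by (simp only: powr_powr add_0_right)
    qed
    ultimately show ?thesis by simp
  qed
  have sq: "t\<^sup>2 * \<bar>t\<bar> powr (r - 2) = \<bar>t\<bar> powr r" if "t \<noteq> 0" for r
  proof -
    have "t\<^sup>2 * \<bar>t\<bar> powr (r - 2) = \<bar>t\<bar> powr 2 * \<bar>t\<bar> powr (r - 2)" using that by simp
    also have "\<dots> = \<bar>t\<bar> powr r" by (subst powr_add[symmetric]) simp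
    finally show ?thesis .
  qed
  show "(\<lambda>n. t * (t * (t\<^sup>2 + e n) powr (p/2 - 1))) \<longlonglongrightarrow> \<bar>t\<bar> powr p"
  \<comment> \<open>At t = 0 the base t^2 + e n tends to 0, where a negative exponent destroys
    continuity. But the outer factor t makes every term 0, and \<open>0 powr p = 0\<close>.\<close>
  proof (cases "t = 0")
    case False
    have "(\<lambda>n. t * (t * (t\<^sup>2 + e n) powr (p/2 - 1))) \<longlonglongrightarrow> t * (t * \<bar>t\<bar> powr (2 * (p/2 - 1)))"
      by (intro tendsto_intros lim False)
    also have "t * (t * \<bar>t\<bar> powr (2 * (p/2 - 1))) = \<bar>t\<bar> powr p"
      using sq[OF False, of p] by (simp add: power2_eq_square right_diff_distrib)
    finally show ?thesis .
  qed simp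
  show "(\<lambda>n. t * (t\<^sup>2 + e n) powr (p/2 - 1) +
        t * ((t\<^sup>2 + e n) powr (p/2 - 1) + (p - 2) * t\<^sup>2 * (t\<^sup>2 + e n) powr (p/2 - 2)))
      \<longlonglongrightarrow> p * t * \<bar>t\<bar> powr (p - 2)"
  proof (cases "t = 0")
    case False
    have "(\<lambda>n. t * (t\<^sup>2 + e n) powr (p/2 - 1) +
        t * ((t\<^sup>2 + e n) powr (p/2 - 1) + (p - 2) * t\<^sup>2 * (t\<^sup>2 + e n) powr (p/2 - 2)))
      \<longlonglongrightarrow> t * \<bar>t\<bar> powr (2 * (p/2 - 1)) +
        t * (\<bar>t\<bar> powr (2 * (p/2 - 1)) + (p - 2) * t\<^sup>2 * \<bar>t\<bar> powr (2 * (p/2 - 2)))"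
      by (intro tendsto_intros lim False)
    also have "t * \<bar>t\<bar> powr (2 * (p/2 - 1)) +
        t * (\<bar>t\<bar> powr (2 * (p/2 - 1)) + (p - 2) * t\<^sup>2 * \<bar>t\<bar> powr (2 * (p/2 - 2)))
        = p * t * \<bar>t\<bar> powr (p - 2)"
    proof -
      have "(p - 2) * t\<^sup>2 * \<bar>t\<bar> powr (2 * (p/2 - 2)) = (p - 2) * \<bar>t\<bar> powr (p - 2)"
        using sq[OF False, of "p - 2"] by (simp add: right_diff_distrib)
      then show ?thesis by (simp only:) (simp add: algebra_simps)
    qed
    finally show ?thesis .
  qed simp
qed


section \<open>The weighted inequality\<close>

lemma weighted_power_inequality:
  fixes \<Omega> \<Gamma>\<^sub>D \<Gamma>\<^sub>N :: "(real^'n) set" and p :: real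
  assumes \<Omega>: "open \<Omega>" "\<Omega> \<inter> \<Gamma>\<^sub>D = {}" and green: "greens_formula_valid \<Omega> \<Gamma>\<^sub>D \<Gamma>\<^sub>N" and p: "1 < p"
    and W: "abs_cont_vec \<Omega> \<Gamma>\<^sub>D W" and \<phi>: "\<phi> \<in> Cc_infinity (- \<Gamma>\<^sub>D)"
    and bd: "AE x in surface_measure. x \<in> \<Gamma>\<^sub>N \<longrightarrow> W x \<bullet> outward_normal \<Omega> x \<le> 0"
  shows "set_integrable lebesgue \<Omega> (\<lambda>x. \<bar>\<phi> x\<bar> powr p * divergence W x)"
    and "set_integrable lebesgue \<Omega> (\<lambda>x. p * \<phi> x * \<bar>\<phi> x\<bar> powr (p - 2) * (W x \<bullet> grad \<phi> x))"
    and "(LINT x:\<Omega>|lebesgue. \<bar>\<phi> x\<bar> powr p * divergence W x)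
      \<le> - (LINT x:\<Omega>|lebesgue. p * \<phi> x * \<bar>\<phi> x\<bar> powr (p - 2) * (W x \<bullet> grad \<phi> x))"
proof -
  define K where "K = closure {x. \<phi> x \<noteq> 0}"
  note D = Cc_infinityD[OF \<phi>]
  have K: "compact K" "K \<inter> \<Gamma>\<^sub>D = {}" using D by (auto simp: K_def)
  have off: "\<phi> x = 0" "grad \<phi> x = 0" if "x \<notin> K" for x
    using grad_eq_0_outside_support[of x \<phi>] that by (auto simp: K_def)
  have c\<phi>: "continuous_on S \<phi>" and cg: "continuous_on S (grad \<phi>)" for S
    using D(1) by (auto intro: continuous_on_C_k_1 continuous_on_grad)
  have cW: "continuous_on (closure \<Omega> \<inter> K) W"
    using K by (intro continuous_on_subset[OF abs_cont_vec_continuous[OF W]]) auto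
  \<comment> \<open>A positive null sequence bounded by 1, the range in which
    \<open>regularised_power_bounds\<close> applies.\<close>
  define e where "e n = 1 / (real n + 1)" for n :: nat
  have e: "0 < e n" "e n \<le> 1" for n by (auto simp: e_def)
  have e0: "e \<longlonglongrightarrow> 0"
    using LIMSEQ_inverse_real_of_nat by (simp add: e_def[abs_def] inverse_eq_divide add.commute)
  define h where "h n t = t * (t\<^sup>2 + e n) powr (p/2 - 1)" for n t
  define h' where "h' n t = (t\<^sup>2 + e n) powr (p/2 - 1) + (p - 2) * t\<^sup>2 * (t\<^sup>2 + e n) powr (p/2 - 2)" for n t
  have h: "(h n has_real_derivative h' n t) (at t)" "continuous_on UNIV (h' n)" "h n 0 = 0" for n t
    unfolding h_def h'_def
    using regularised_power_deriv[OF e(1)]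
    by (auto intro!: continuous_on_add continuous_on_mult continuous_on_regularised_power e
        continuous_intros)
  note G = green_compose[OF \<Omega> green W \<phi> h]
  have neg: "(LINT x:\<Gamma>\<^sub>N|surface_measure. \<phi> x * h n (\<phi> x) * (W x \<bullet> outward_normal \<Omega> x)) \<le> 0" for n
  proof -
    \<comment> \<open>t h(t) is t^2 times a power, hence nonnegative, so the boundary integrand
      inherits the sign of the flux of \<open>W\<close>.\<close>
    have "0 \<le> \<phi> x * h n (\<phi> x)" for x
      by (simp add: h_def flip: mult.assoc)
    then have "AE x in surface_measure.
        0 \<le> - (indicator \<Gamma>\<^sub>N x *\<^sub>R (\<phi> x * h n (\<phi> x) * (W x \<bullet> outward_normal \<Omega> x)))"
      using bd by (auto elim!: eventually_mono simp: indicator_def mult_nonneg_nonpos)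
    from integral_nonneg_AE[OF this] show ?thesis by (simp add: set_lebesgue_integral_def)
  qed
  have ineq: "(LINT x:\<Omega>|lebesgue. \<phi> x * h n (\<phi> x) * divergence W x)
      \<le> - (LINT x:\<Omega>|lebesgue. (h n (\<phi> x) + \<phi> x * h' n (\<phi> x)) * (W x \<bullet> grad \<phi> x))" for n
    using G(1)[of n] neg[of n] by simp
  have cp: "continuous_on S (\<lambda>x. ((\<phi> x)\<^sup>2 + 1) powr r)" for S r
    by (rule continuous_on_compose2[OF continuous_on_regularised_power[of 1 UNIV r] c\<phi>]) auto
  \<comment> \<open>Off \<open>K\<close> the power equals 1, while div W need not be integrable on
    all of \<Omega>; the indicator removes that region. In \<open>?w2\<close> below, the gradient of
    \<phi> does the same.\<close>
  let ?w1 = "\<lambda>x. indicator K x * \<bar>((\<phi> x)\<^sup>2 + 1) powr (p/2) * divergence W x\<bar>"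
  have "set_integrable lebesgue (\<Omega> \<inter> K) (\<lambda>x. \<bar>((\<phi> x)\<^sup>2 + 1) powr (p/2) * divergence W x\<bar>)"
    by (intro set_integrable_abs set_integrable_mult_divergence[OF \<Omega>(1) W K] cp)
  then have "set_integrable lebesgue (\<Omega> \<inter> K) ?w1"
    by (rule set_integrable_cong[THEN iffD1, rotated -1]) auto
  then have w1: "set_integrable lebesgue \<Omega> ?w1"
    by (rule set_integrable_IntD) auto
  have b1: "\<bar>\<phi> x * h n (\<phi> x) * divergence W x\<bar> \<le> ?w1 x" for n x
    using mult_right_mono[OF regularised_power_bounds(1)[OF p e[of n], of "\<phi> x"], of "\<bar>divergence W x\<bar>"]
    by (cases "x \<in> K") (auto simp: off abs_mult h_def)
  have l1: "(\<lambda>n. \<phi> x * h n (\<phi> x) * divergence W x) \<longlonglongrightarrow> \<bar>\<phi> x\<bar> powr p * divergence W x" for x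
    unfolding h_def by (intro tendsto_mult tendsto_const regularised_power_tendsto(1) p e0)
  note L1 = set_integral_dominated_convergence[OF G(2) w1 l1 b1]
  let ?w2 = "\<lambda>x. (2 + \<bar>p - 2\<bar>) * ((\<phi> x)\<^sup>2 + 1) powr ((p - 1)/2) * \<bar>W x \<bullet> grad \<phi> x\<bar>"
  have "set_integrable lebesgue (\<Omega> \<inter> K) ?w2"
    by (intro set_integrable_continuous_Int_compact \<Omega> K continuous_on_mult cp continuous_on_const
        continuous_on_rabs continuous_on_inner cW cg)
  then have w2: "set_integrable lebesgue \<Omega> ?w2"
    by (rule set_integrable_IntD) (auto simp: off)
  have b2: "\<bar>(h n (\<phi> x) + \<phi> x * h' n (\<phi> x)) * (W x \<bullet> grad \<phi> x)\<bar> \<le> ?w2 x" for n x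
    using mult_right_mono[OF regularised_power_bounds(2)[OF p e[of n], of "\<phi> x"], of "\<bar>W x \<bullet> grad \<phi> x\<bar>"]
    by (simp add: abs_mult h_def h'_def)
  have l2: "(\<lambda>n. (h n (\<phi> x) + \<phi> x * h' n (\<phi> x)) * (W x \<bullet> grad \<phi> x))
      \<longlonglongrightarrow> p * \<phi> x * \<bar>\<phi> x\<bar> powr (p - 2) * (W x \<bullet> grad \<phi> x)" for x
    unfolding h_def h'_def by (intro tendsto_mult[OF _ tendsto_const] regularised_power_tendsto(2) p e0)
  note L2 = set_integral_dominated_convergence[OF G(3) w2 l2 b2]
  show "set_integrable lebesgue \<Omega> (\<lambda>x. \<bar>\<phi> x\<bar> powr p * divergence W x)" by (rule L1(1))
  show "set_integrable lebesgue \<Omega> (\<lambda>x. p * \<phi> x * \<bar>\<phi> x\<bar> powr (p - 2) * (W x \<bullet> grad \<phi> x))"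
    by (rule L2(1))
  show "(LINT x:\<Omega>|lebesgue. \<bar>\<phi> x\<bar> powr p * divergence W x)
      \<le> - (LINT x:\<Omega>|lebesgue. p * \<phi> x * \<bar>\<phi> x\<bar> powr (p - 2) * (W x \<bullet> grad \<phi> x))"
    by (rule LIMSEQ_le[OF L1(2) tendsto_minus[OF L2(2)]]) (use ineq in auto)
qed

text \<open>Young's inequality for b and |t|^(p-1) a with exponents p and p', multiplied by p. The
  identity (p - 1) p' = p produces |t|^p, and p / p' = p - 1 is the constant of the theorem.\<close>

lemma young_power:
  fixes p p' a b t :: real
  assumes p: "1 < p" "p' = p / (p - 1)" and ab: "0 \<le> a" "0 \<le> b"
  shows "p * \<bar>t\<bar> * \<bar>t\<bar> powr (p - 2) * (a * b) \<le> b powr p + (p - 1) * a powr p' * \<bar>t\<bar> powr p"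
proof -
  have p': "p' > 1" "1/p + 1/p' = 1" "p / p' = p - 1" "(p - 1) * p' = p"
    using p(1) unfolding p(2) by (auto simp: field_simps)
  have eq: "\<bar>t\<bar> * \<bar>t\<bar> powr (p - 2) = \<bar>t\<bar> powr (p - 1)"
    by (simp add: powr_mult_base)
  have "b * (\<bar>t\<bar> powr (p - 1) * a) \<le> b powr p / p + (\<bar>t\<bar> powr (p - 1) * a) powr p' / p'"
    using p p' ab by (intro Youngs_inequality) auto
  also have "(\<bar>t\<bar> powr (p - 1) * a) powr p' = \<bar>t\<bar> powr p * a powr p'"
    using ab p' by (simp add: powr_mult powr_powr)
  finally have "p * (b * (\<bar>t\<bar> powr (p - 1) * a)) \<le> p * (b powr p / p + \<bar>t\<bar> powr p * a powr p' / p')"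
    using p by (intro mult_left_mono) auto
  also have "\<dots> = b powr p + (p / p') * (\<bar>t\<bar> powr p * a powr p')"
    using p by (simp add: field_simps)
  finally show ?thesis using p' eq by (simp add: mult_ac)
qed

text \<open>Integrability is concluded along with the estimate because the scalar case changes the
  integrand on a null set, and \<open>set_integrable_lebesgue_cong_AE\<close> starts from an
  integrable function.\<close>

theorem vector_field_inequality:
  fixes \<Omega> \<Gamma>\<^sub>D \<Gamma>\<^sub>N :: "(real^'n) set" and p p' :: real
    and Q :: "real^'n \<Rightarrow> real^'n" and A :: "real^'n \<Rightarrow> real^'n^'n"
  assumes \<Omega>: "open \<Omega>" "\<Omega> \<inter> \<Gamma>\<^sub>D = {}" and green: "greens_formula_valid \<Omega> \<Gamma>\<^sub>D \<Gamma>\<^sub>N"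
    and p: "1 < p" "p' = p / (p - 1)"
    and Q: "abs_cont_vec \<Omega> \<Gamma>\<^sub>D Q" and A: "abs_cont_mat \<Omega> \<Gamma>\<^sub>D A"
    and bd: "AE x in surface_measure. x \<in> \<Gamma>\<^sub>N \<longrightarrow>
           outward_normal \<Omega> x \<bullet> (transpose (A x) *v Q x) \<le> 0"
    and \<zeta>: "\<zeta> \<in> test_functions \<Omega> \<Gamma>\<^sub>D"
  shows "set_integrable lebesgue \<Omega> (\<lambda>x.
      (divergence (\<lambda>y. transpose (A y) *v Q y) x - (p - 1) * norm (Q x) powr p') * \<bar>\<zeta> x\<bar> powr p)"
    and "(LINT x:\<Omega>|lebesgue.
      (divergence (\<lambda>y. transpose (A y) *v Q y) x - (p - 1) * norm (Q x) powr p') * \<bar>\<zeta> x\<bar> powr p)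
    \<le> (LINT x:\<Omega>|lebesgue. norm (A x *v grad \<zeta> x) powr p)"
proof -
  obtain \<phi> where \<phi>: "\<phi> \<in> Cc_infinity (- \<Gamma>\<^sub>D)" and \<zeta>\<phi>: "\<And>x. x \<in> \<Omega> \<Longrightarrow> \<zeta> x = \<phi> x"
    using \<zeta> by (auto simp: test_functions_def)
  have grad: "grad \<zeta> x = grad \<phi> x" if "x \<in> \<Omega>" for x
    using grad_cong_open[OF \<Omega>(1) that] \<zeta>\<phi> by blast
  define W where "W x = transpose (A x) *v Q x" for x
  define K where "K = closure {x. \<phi> x \<noteq> 0}"
  note D = Cc_infinityD[OF \<phi>]
  have K: "compact K" "K \<inter> \<Gamma>\<^sub>D = {}" using D by (auto simp: K_def)
  have off: "\<phi> x = 0" "grad \<phi> x = 0" if "x \<notin> K" for x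
    using grad_eq_0_outside_support[of x \<phi>] that by (auto simp: K_def)
  have c\<phi>: "continuous_on S \<phi>" and cg: "continuous_on S (grad \<phi>)" for S
    using D(1) by (auto intro: continuous_on_C_k_1 continuous_on_grad)
  have cQ: "continuous_on (closure \<Omega> \<inter> K) Q"
    using K by (intro continuous_on_subset[OF abs_cont_vec_continuous[OF Q]]) auto
  have cA: "continuous_on (closure \<Omega> \<inter> K) (\<lambda>x. A x $ i $ j)" for i j
    using K A by (intro continuous_on_subset[OF abs_cont_continuous[of \<Omega> \<Gamma>\<^sub>D]]) (auto simp: abs_cont_mat_def)
  have W: "abs_cont_vec \<Omega> \<Gamma>\<^sub>D W"
    unfolding abs_cont_vec_def W_def matrix_vector_mult_def
    using Q A by (auto simp: abs_cont_vec_def abs_cont_mat_def transpose_def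
        intro!: abs_cont_sum abs_cont_mult \<Omega>)
  have "AE x in surface_measure. x \<in> \<Gamma>\<^sub>N \<longrightarrow> W x \<bullet> outward_normal \<Omega> x \<le> 0"
    using bd by (simp add: W_def inner_commute)
  note key = weighted_power_inequality[OF \<Omega> green p(1) W \<phi> this]
  have "continuous_on (closure \<Omega> \<inter> K) (\<lambda>x. norm (A x *v grad \<phi> x) powr p)"
    unfolding matrix_vector_mult_def using p
    by (intro continuous_on_powr' continuous_on_norm continuous_on_vec_lambda continuous_on_sum
        continuous_on_mult cA continuous_on_component cg continuous_on_const) auto
  from set_integrable_continuous_Int_compact[OF \<Omega>(1) K(1) this]
  have i1: "set_integrable lebesgue \<Omega> (\<lambda>x. norm (A x *v grad \<phi> x) powr p)"
    by (rule set_integrable_IntD) (auto simp: off)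
  \<comment> \<open>A positive exponent makes \<open>powr\<close> continuous also at points where
    \<open>Q\<close> vanishes.\<close>
  have "p' > 0" using p by simp
  then have "continuous_on (closure \<Omega> \<inter> K) (\<lambda>x. (p - 1) * norm (Q x) powr p' * \<bar>\<phi> x\<bar> powr p)"
    using p by (intro continuous_on_powr' continuous_on_norm continuous_on_rabs cQ c\<phi>
        continuous_on_mult continuous_on_const) auto
  from set_integrable_continuous_Int_compact[OF \<Omega>(1) K(1) this]
  have i2: "set_integrable lebesgue \<Omega> (\<lambda>x. (p - 1) * norm (Q x) powr p' * \<bar>\<phi> x\<bar> powr p)"
    by (rule set_integrable_IntD) (auto simp: off)
  \<comment> \<open>The transpose moves \<open>A\<close> onto the gradient; then come Cauchy-Schwarz
    and \<open>young_power\<close> with a = |Q| and b = |A grad \<phi>|.\<close>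
  have pointwise: "- (p * \<phi> x * \<bar>\<phi> x\<bar> powr (p - 2) * (W x \<bullet> grad \<phi> x))
      \<le> norm (A x *v grad \<phi> x) powr p + (p - 1) * norm (Q x) powr p' * \<bar>\<phi> x\<bar> powr p" for x
  proof -
    have "W x \<bullet> grad \<phi> x = Q x \<bullet> (A x *v grad \<phi> x)"
      by (simp add: W_def dot_lmul_matrix)
    then have "\<bar>W x \<bullet> grad \<phi> x\<bar> \<le> norm (Q x) * norm (A x *v grad \<phi> x)"
      by (simp add: Cauchy_Schwarz_ineq2)
    then have "p * \<bar>\<phi> x\<bar> * \<bar>\<phi> x\<bar> powr (p - 2) * \<bar>W x \<bullet> grad \<phi> x\<bar>
        \<le> p * \<bar>\<phi> x\<bar> * \<bar>\<phi> x\<bar> powr (p - 2) * (norm (Q x) * norm (A x *v grad \<phi> x))"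
      using p by (intro mult_left_mono) auto
    moreover have "- (p * \<phi> x * \<bar>\<phi> x\<bar> powr (p - 2) * (W x \<bullet> grad \<phi> x))
        \<le> p * \<bar>\<phi> x\<bar> * \<bar>\<phi> x\<bar> powr (p - 2) * \<bar>W x \<bullet> grad \<phi> x\<bar>"
      using p abs_ge_minus_self[of "p * \<phi> x * \<bar>\<phi> x\<bar> powr (p - 2) * (W x \<bullet> grad \<phi> x)"]
      by (simp add: abs_mult)
    ultimately show ?thesis
      using young_power[OF p, of "norm (Q x)" "norm (A x *v grad \<phi> x)" "\<phi> x"] by simp
  qed
  have "(LINT x:\<Omega>|lebesgue.
      (divergence (\<lambda>y. transpose (A y) *v Q y) x - (p - 1) * norm (Q x) powr p') * \<bar>\<zeta> x\<bar> powr p) =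
      (LINT x:\<Omega>|lebesgue. \<bar>\<phi> x\<bar> powr p * divergence W x - (p - 1) * norm (Q x) powr p' * \<bar>\<phi> x\<bar> powr p)"
    using \<Omega>(1) by (intro set_lebesgue_integral_cong) (auto simp: \<zeta>\<phi> W_def[abs_def] algebra_simps)
  also have "\<dots> = (LINT x:\<Omega>|lebesgue. \<bar>\<phi> x\<bar> powr p * divergence W x) -
      (LINT x:\<Omega>|lebesgue. (p - 1) * norm (Q x) powr p' * \<bar>\<phi> x\<bar> powr p)"
    by (rule set_integral_diff(2)[OF key(1) i2])
  also have "\<dots> \<le> (LINT x:\<Omega>|lebesgue. norm (A x *v grad \<phi> x) powr p)"
  proof -
    have "- (LINT x:\<Omega>|lebesgue. p * \<phi> x * \<bar>\<phi> x\<bar> powr (p - 2) * (W x \<bullet> grad \<phi> x)) =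
        (LINT x:\<Omega>|lebesgue. - (p * \<phi> x * \<bar>\<phi> x\<bar> powr (p - 2) * (W x \<bullet> grad \<phi> x)))"
      by (rule set_integral_uminus[OF key(2), symmetric])
    also have "\<dots> \<le> (LINT x:\<Omega>|lebesgue.
        norm (A x *v grad \<phi> x) powr p + (p - 1) * norm (Q x) powr p' * \<bar>\<phi> x\<bar> powr p)"
    proof (rule set_integral_mono)
      show "set_integrable lebesgue \<Omega> (\<lambda>x. - (p * \<phi> x * \<bar>\<phi> x\<bar> powr (p - 2) * (W x \<bullet> grad \<phi> x)))"
        using key(2) by (simp add: set_integrable_def)
    qed (use pointwise set_integral_add(1)[OF i1 i2] in auto)
    also have "\<dots> = (LINT x:\<Omega>|lebesgue. norm (A x *v grad \<phi> x) powr p) +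
        (LINT x:\<Omega>|lebesgue. (p - 1) * norm (Q x) powr p' * \<bar>\<phi> x\<bar> powr p)"
      by (rule set_integral_add(2)[OF i1 i2])
    finally show ?thesis using key(3) by simp
  qed
  also have "\<dots> = (LINT x:\<Omega>|lebesgue. norm (A x *v grad \<zeta> x) powr p)"
    using \<Omega>(1) by (intro set_lebesgue_integral_cong) (auto simp: grad)
  finally show "(LINT x:\<Omega>|lebesgue.
      (divergence (\<lambda>y. transpose (A y) *v Q y) x - (p - 1) * norm (Q x) powr p') * \<bar>\<zeta> x\<bar> powr p)
    \<le> (LINT x:\<Omega>|lebesgue. norm (A x *v grad \<zeta> x) powr p)" .
  show "set_integrable lebesgue \<Omega> (\<lambda>x.
      (divergence (\<lambda>y. transpose (A y) *v Q y) x - (p - 1) * norm (Q x) powr p') * \<bar>\<zeta> x\<bar> powr p)"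
    using set_integral_diff(1)[OF key(1) i2]
    by (rule set_integrable_cong[THEN iffD1, rotated -1]) (auto simp: \<zeta>\<phi> W_def[abs_def] algebra_simps)
qed

theorem lemmaI1:
  fixes \<Omega> \<Gamma>\<^sub>D \<Gamma>\<^sub>N :: "(real^'n) set" and p p' :: real
  assumes "regular_domain \<Omega>"
    and "boundary_decomposition \<Omega> \<Gamma>\<^sub>D \<Gamma>\<^sub>N"
    and "greens_formula_valid \<Omega> \<Gamma>\<^sub>D \<Gamma>\<^sub>N"
    and "1 < p" and "p' = p / (p - 1)"
  shows
    "(\<forall>(Q :: real^'n \<Rightarrow> real^'n) (A :: real^'n \<Rightarrow> real^'n^'n).
        abs_cont_vec \<Omega> \<Gamma>\<^sub>D Q \<and> abs_cont_mat \<Omega> \<Gamma>\<^sub>D A \<and>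
        (AE x in surface_measure. x \<in> \<Gamma>\<^sub>N \<longrightarrow>
           outward_normal \<Omega> x \<bullet> (transpose (A x) *v Q x) \<le> 0) \<longrightarrow>
        (\<forall>\<zeta>\<in>test_functions \<Omega> \<Gamma>\<^sub>D.
           (LINT x:\<Omega>|lebesgue. norm (A x *v grad \<zeta> x) powr p) \<ge>
           (LINT x:\<Omega>|lebesgue.
              (divergence (\<lambda>y. transpose (A y) *v Q y) x - (p - 1) * norm (Q x) powr p')
                * \<bar>\<zeta> x\<bar> powr p))) \<and>
     (\<forall>(a :: real^'n \<Rightarrow> real) (q :: real^'n \<Rightarrow> real) (u :: real^'n).
        abs_cont \<Omega> \<Gamma>\<^sub>D a \<and> abs_cont \<Omega> \<Gamma>\<^sub>D q \<and> norm u = 1 \<and>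
        (AE x in surface_measure. x \<in> \<Gamma>\<^sub>N \<longrightarrow>
           a x * q x * (u \<bullet> outward_normal \<Omega> x) \<le> 0) \<longrightarrow>
        (\<forall>\<zeta>\<in>test_functions \<Omega> \<Gamma>\<^sub>D.
           (LINT x:\<Omega>|lebesgue. \<bar>a x * (u \<bullet> grad \<zeta> x)\<bar> powr p) \<ge>
           (LINT x:\<Omega>|lebesgue.
              (u \<bullet> grad (\<lambda>y. a y * q y) x - (p - 1) * \<bar>q x\<bar> powr p')
                * \<bar>\<zeta> x\<bar> powr p)))"
proof -
  have \<Omega>: "open \<Omega>" "\<Omega> \<inter> \<Gamma>\<^sub>D = {}"
    using assms(1,2) by (auto simp: regular_domain_def boundary_decomposition_def frontier_def interior_open)
  note main = vector_field_inequality[OF \<Omega> assms(3-5)]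
  have "(LINT x:\<Omega>|lebesgue. (u \<bullet> grad (\<lambda>y. a y * q y) x - (p - 1) * \<bar>q x\<bar> powr p') * \<bar>\<zeta> x\<bar> powr p)
      \<le> (LINT x:\<Omega>|lebesgue. \<bar>a x * (u \<bullet> grad \<zeta> x)\<bar> powr p)"
    if a: "abs_cont \<Omega> \<Gamma>\<^sub>D a" and q: "abs_cont \<Omega> \<Gamma>\<^sub>D q" and u: "norm u = 1"
      and bd: "AE x in surface_measure. x \<in> \<Gamma>\<^sub>N \<longrightarrow> a x * q x * (u \<bullet> outward_normal \<Omega> x) \<le> 0"
      and \<zeta>: "\<zeta> \<in> test_functions \<Omega> \<Gamma>\<^sub>D"
    for a q u \<zeta>
  proof -
    \<comment> \<open>A maps v to a (u . v) u, of length |a (u . v)| because u is a unit vector. As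
      A is symmetric and u . u = 1, the field A^T Q is a q u, whose flux is the one in the scalar
      hypothesis.\<close>
    define A where "A x = (\<chi> i j. a x * (u $ i * u $ j))" for x
    define Q where "Q x = q x *\<^sub>R u" for x
    have uu: "u \<bullet> u = 1" using u by (simp add: norm_eq_1)
    have Av: "A x *v v = (a x * (u \<bullet> v)) *\<^sub>R u" for x v
      by (simp add: vec_eq_iff A_def matrix_vector_mult_def inner_vec_def sum_distrib_left mult_ac)
    have "transpose (A x) = A x" for x
      by (simp add: A_def transpose_def vec_eq_iff mult_ac)
    then have W: "transpose (A x) *v Q x = (a x * q x) *\<^sub>R u" for x
      using Av by (simp add: Q_def uu)
    have "abs_cont_vec \<Omega> \<Gamma>\<^sub>D Q" "abs_cont_mat \<Omega> \<Gamma>\<^sub>D A"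
      unfolding abs_cont_vec_def abs_cont_mat_def Q_def A_def
      by (auto intro!: abs_cont_mult[OF \<Omega>] abs_cont_const \<Omega> a q)
    moreover have "AE x in surface_measure. x \<in> \<Gamma>\<^sub>N \<longrightarrow>
        outward_normal \<Omega> x \<bullet> (transpose (A x) *v Q x) \<le> 0"
      unfolding W using bd by (simp add: inner_commute)
    ultimately have
      int: "set_integrable lebesgue \<Omega> (\<lambda>x. (divergence (\<lambda>y. transpose (A y) *v Q y) x -
        (p - 1) * norm (Q x) powr p') * \<bar>\<zeta> x\<bar> powr p)" and
      ineq: "(LINT x:\<Omega>|lebesgue. (divergence (\<lambda>y. transpose (A y) *v Q y) x -
        (p - 1) * norm (Q x) powr p') * \<bar>\<zeta> x\<bar> powr p)
        \<le> (LINT x:\<Omega>|lebesgue. norm (A x *v grad \<zeta> x) powr p)"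
      using main[of Q A \<zeta>] \<zeta> by blast+
    \<comment> \<open>The i-th component of the field is (a q) u_i. Pulling the constant u_i out of
      \<open>partial\<close> is justified where a q has a derivative along the axis, so div (a q u)
      is compared with u . grad (a q) almost everywhere only.\<close>
    have "AE x in lebesgue. \<forall>i\<in>UNIV. x \<in> \<Omega> \<longrightarrow>
        partial i (\<lambda>y. (a y * q y) * u $ i) x = u $ i * partial i (\<lambda>y. a y * q y) x"
      using partial_mult_AE[OF abs_cont_mult[OF \<Omega> a q] abs_cont_const[OF \<Omega>(1)], of _ "u $ _"]
      by (intro AE_finite_allI) auto
    then have "AE x in lebesgue. x \<in> \<Omega> \<longrightarrow>
        (divergence (\<lambda>y. transpose (A y) *v Q y) x - (p - 1) * norm (Q x) powr p') * \<bar>\<zeta> x\<bar> powr p =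
        (u \<bullet> grad (\<lambda>y. a y * q y) x - (p - 1) * \<bar>q x\<bar> powr p') * \<bar>\<zeta> x\<bar> powr p"
      unfolding W by eventually_elim (simp add: divergence_def inner_vec_def grad_def Q_def u)
    from set_integrable_lebesgue_cong_AE(2)[OF int this] ineq show ?thesis
      by (simp add: Av u)
  qed
  then show ?thesis using main(2) by blast
qed

end
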